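(* Let $Y\subset\mathbb{R}^n$ be a Lebesgue measurable set of finite positive Lebesgue measure, and let $u^{\#}:Y\to\mathbb{R}^n$ be integrable and equal to the restriction to $Y$ of the gradient of a proper lower semicontinuous convex function $\psi:\mathbb{R}^n\to\overline{\mathbb{R}}$. Suppose that $u^{\#}$, restricted to the complement of its level sets of positive measure, is not almost injective. Let $(X,\mu)$ be a measure-interval with $\mu(X)=\lambda_n(Y)$, and let $u:X\to\mathbb{R}^n$ be a rearrangement of $u^{\#}$ which is almost countable to one on the complement of its level sets of positive measure. Then $u$ does not have a polar factorisation through $Y$.
   Context: $\lambda_n$ denotes $n$-dimensional Lebesgue measure and $\overline{\mathbb{R}}=\mathbb{R}\cup\{-\infty,+\infty\}$. A function $\psi:\mathbb{R}^n\to\overline{\mathbb{R}}$ is proper if it is not identically $+\infty$ and never takes the value $-\infty$. A finite complete measure space $(X,\mu)$ is a measure-interval if it is isomorphic to $[0,\mu(X)]$ with Lebesgue measure (on the Lebesgue sets): there exist sets of full measure $X'\subset X$, $I'\subset[0,\mu(X)]$ and a bijection $\tau:X'\to I'$ such that $\tau$ and $\tau^{-1}$ are measurable and measure-preserving. For finite measure spaces $(X,\mu)$, $(Y,\nu)$ with $\mu(X)=\nu(Y)$, functions $f\in L^1(X,\mu,\mathbb{R}^n)$ and $g\in L^1(Y,\nu,\mathbb{R}^n)$ are rearrangements of each other if $\mu(f^{-1}(B))=\nu(g^{-1}(B))$ for every Borel set $B\subset\mathbb{R}^n$. A measure-preserving mapping from $(X,\mu)$ to $(Y,\lambda_n)$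 (with $\mu(X)=\lambda_n(Y)$) is a map $s:X\to Y$ with $\mu(s^{-1}(A))=\lambda_n(A)$ for every Borel (equivalently Lebesgue measurable) $A\subset Y$. For $u\in L^1(X,\mu,\mathbb{R}^n)$ with $(X,\mu)$ a measure-interval and $Y\subset\mathbb{R}^n$ Lebesgue measurable with $\lambda_n(Y)=\mu(X)$, the monotone rearrangement of $u$ on $Y$ is the (almost everywhere unique) function $u^{\#}:Y\to\mathbb{R}^n$ which is a rearrangement of $u$ and satisfies $u^{\#}=\nabla\psi$ a.e. in $Y$ for some proper lower semicontinuous convex $\psi:\mathbb{R}^n\to\overline{\mathbb{R}}$. We say $u$ has a polar factorisation through $Y$ if there is a measure-preserving mapping $s$ from $(X,\mu)$ to $(Y,\lambda_n)$ with $u=u^{\#}\circ s$ $\mu$-almost everywhere. For a map $f:U\to\mathbb{R}^n$ on a finite measure space $(U,\mu)$: a level set is a set $f^{-1}(a)$, $a\in\mathbb{R}^n$; the complement of its level sets of positive measure is $U_0=U\setminus\bigcup\{f^{-1}(a):\mu(f^{-1}(a))>0\}$. $f$ is almost injective if there is $U'\subset U$ with $\mu(U\setminus U')=0$ and $f|_{U'}$ injective; $f$ is almost countable to one if there is $U'$ of full measure such that every level set of $f$ has countable intersection with $U'$. A property "on the complement of its level sets of positive measure" means the property holds for the restriction $f|_{U_0}$ with respect to $\mu$ restricted to $U_0$. *)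

theory Defs
  imports "HOL-Analysis.Analysis"
begin

definition proper_fun :: "('a \<Rightarrow> ereal) \<Rightarrow> bool" where
  "proper_fun \<psi> \<longleftrightarrow> (\<exists>x. \<psi> x \<noteq> \<infinity>) \<and> (\<forall>x. \<psi> x \<noteq> -\<infinity>)"

definition lsc_fun :: "('a::topological_space \<Rightarrow> ereal) \<Rightarrow> bool" where
  "lsc_fun \<psi> \<longleftrightarrow> (\<forall>x c. c < \<psi> x \<longrightarrow> (\<forall>\<^sub>F y in nhds x. c < \<psi> y))"

definition convex_fun :: "('a::real_vector \<Rightarrow> ereal) \<Rightarrow> bool" where
  "convex_fun \<psi> \<longleftrightarrow> convex {(x, r::real). \<psi> x \<le> ereal r}"

definition gradient_at :: "('a::euclidean_space \<Rightarrow> ereal) \<Rightarrow> 'a \<Rightarrow> 'a \<Rightarrow> bool" where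
  "gradient_at \<psi> y g \<longleftrightarrow> (\<forall>\<^sub>F x in nhds y. \<bar>\<psi> x\<bar> \<noteq> \<infinity>) \<and>
     ((\<lambda>x. real_of_ereal (\<psi> x)) has_derivative (\<lambda>h. g \<bullet> h)) (at y)"

definition measure_interval :: "'b measure \<Rightarrow> bool" where
  "measure_interval M \<longleftrightarrow> finite_measure M \<and> complete_measure M \<and>
     (\<exists>X' I' (\<tau> :: 'b \<Rightarrow> real).
        X' \<in> sets M \<and> X' \<subseteq> space M \<and> space M - X' \<in> null_sets M \<and>
        I' \<in> sets lebesgue \<and> I' \<subseteq> {0 .. measure M (space M)} \<and>
        {0 .. measure M (space M)} - I' \<in> null_sets lebesgue \<and>
        bij_betw \<tau> X' I' \<and>
        (\<forall>A. A \<in> sets lebesgue \<and> A \<subseteq> I' \<longrightarrow>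
             \<tau> -` A \<inter> X' \<in> sets M \<and> emeasure M (\<tau> -` A \<inter> X') = emeasure lebesgue A) \<and>
        (\<forall>B. B \<in> sets M \<and> B \<subseteq> X' \<longrightarrow>
             \<tau> ` B \<in> sets lebesgue \<and> emeasure lebesgue (\<tau> ` B) = emeasure M B))"

definition rearrangement ::
  "'b measure \<Rightarrow> ('b \<Rightarrow> 'a::euclidean_space) \<Rightarrow> 'c measure \<Rightarrow> ('c \<Rightarrow> 'a) \<Rightarrow> bool" where
  "rearrangement M f N g \<longleftrightarrow>
     finite_measure M \<and> finite_measure N \<and> emeasure M (space M) = emeasure N (space N) \<and>
     integrable M f \<and> integrable N g \<and>
     (\<forall>B \<in> sets borel. emeasure M (f -` B \<inter> space M) = emeasure N (g -` B \<inter> space N))"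

definition measure_preserving_map :: "'b measure \<Rightarrow> 'a::euclidean_space set \<Rightarrow> ('b \<Rightarrow> 'a) \<Rightarrow> bool" where
  "measure_preserving_map M Y s \<longleftrightarrow>
     emeasure M (space M) = emeasure lebesgue Y \<and> s ` space M \<subseteq> Y \<and>
     (\<forall>A \<in> sets borel. A \<subseteq> Y \<longrightarrow>
        s -` A \<inter> space M \<in> sets M \<and> emeasure M (s -` A \<inter> space M) = emeasure lebesgue A)"

definition monotone_rearrangement ::
  "'b measure \<Rightarrow> ('b \<Rightarrow> 'a::euclidean_space) \<Rightarrow> 'a set \<Rightarrow> ('a \<Rightarrow> 'a) \<Rightarrow> bool" where
  "monotone_rearrangement M u Y v \<longleftrightarrow>
     rearrangement M u (lebesgue_on Y) v \<and>
     (\<exists>\<psi>. proper_fun \<psi> \<and> lsc_fun \<psi> \<and> convex_fun \<psi> \<and>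
        (AE y in lebesgue_on Y. gradient_at \<psi> y (v y)))"

text \<open>Polar factorisation of \<open>u\<close> through \<open>Y\<close>: \<open>u = u\<^sup># \<circ> s\<close> a.e. with \<open>u\<^sup>#\<close> the
  (a.e. unique) monotone rearrangement and \<open>s\<close> measure-preserving.\<close>
definition has_polar_factorisation :: "'b measure \<Rightarrow> ('b \<Rightarrow> 'a::euclidean_space) \<Rightarrow> 'a set \<Rightarrow> bool" where
  "has_polar_factorisation M u Y \<longleftrightarrow>
     (\<exists>v s. monotone_rearrangement M u Y v \<and> measure_preserving_map M Y s \<and>
        (AE x in M. u x = v (s x)))"

definition pos_level_complement :: "'b measure \<Rightarrow> ('b \<Rightarrow> 'a) \<Rightarrow> 'b set" where
  "pos_level_complement M f =
     space M - \<Union>{f -` {a} \<inter> space M | a. emeasure M (f -` {a} \<inter> space M) > 0}"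

definition almost_injective_on :: "'b measure \<Rightarrow> ('b \<Rightarrow> 'a) \<Rightarrow> 'b set \<Rightarrow> bool" where
  "almost_injective_on M f U \<longleftrightarrow> (\<exists>U' \<subseteq> U. U - U' \<in> null_sets M \<and> inj_on f U')"

definition almost_countable_to_one_on :: "'b measure \<Rightarrow> ('b \<Rightarrow> 'a) \<Rightarrow> 'b set \<Rightarrow> bool" where
  "almost_countable_to_one_on M f U \<longleftrightarrow>
     (\<exists>U' \<subseteq> U. U - U' \<in> null_sets M \<and> (\<forall>a. countable (f -` {a} \<inter> U')))"

end

theory Submission
  imports Defs
begin

text \<open>
  The polar factorisation gives \<open>u = u\<^sup># \<circ> s\<close>, the monotone rearrangement being unique by an
  argument of Aleksandrov and McCann. Since \<open>s\<close> is measure preserving on a measure-interval, its image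
  fills almost all of the complement of the level sets of positive measure of \<open>u\<^sup>#\<close>, so \<open>u\<^sup>#\<close> is
  almost countable to one there. It remains to see that a gradient of a convex function which is
  countable to one on a set \<open>F\<close> is injective on almost all of \<open>F\<close>. Otherwise there are disjoint compact
  sets \<open>A, L \<subseteq> F\<close>, with \<open>A\<close> of positive measure, such that every fibre meeting \<open>A\<close> meets \<open>L\<close>.
  Moving \<open>A\<close> a fraction \<open>t\<close> of the way towards \<open>L\<close> inside the fibres shrinks measure by no more than
  the factor \<open>(1 - t)\<close> to the power of the dimension. As a point is reached at only countably many times
  \<open>t\<close>, this contradicts Fubini's theorem.
\<close>

section \<open>Gradients of extended-valued convex functions\<close>

text \<open>Choosing a partner in \<open>L\<close> is a maximisation: if \<open>v\<close> takes the
  slope \<open>a\<close> on \<open>L\<close>, then the \<open>c\<close> in \<open>L\<close> with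
  \<open>v c = a\<close> are exactly the maximisers on \<open>L\<close> of
  \<open>a \<bullet> c - f c\<close>, as in the Legendre transform of \<open>f\<close>. Maximisers
  depend monotonically on \<open>a\<close>, and \<open>v\<close> is itself monotone; so two points
  moving towards their partners are never driven together faster than by the factor 1 - t. An exact
  maximiser may be neither unique nor measurable in the point, so \<open>L\<close> is replaced by
  finitely many centres: \<open>A\<close> then splits into cells, each moved by a homothety, and
  compactness gives the passage to the limit. Fubini only asks that a point be met at a null set of
  times, which is why countable fibres suffice; the disjointness of \<open>A\<close> and
  \<open>L\<close> gives each pair at most one time at a given point. Images of measurable sets need
  not be measurable. Every set to be mapped is therefore first exhausted, up to a null set, by
  compact sets on which the map is continuous.\<close>

lemma gradient_at_finite: "gradient_at \<psi> y g \<Longrightarrow> \<psi> y = ereal (real_of_ereal (\<psi> y))"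
  unfolding gradient_at_def using eventually_nhds_x_imp_x ereal_real by fastforce

lemma gradient_at_first_order:
  assumes "gradient_at \<psi> y g" "0 < e"
  obtains d where "0 < d" "\<And>z. norm (z - y) < d \<Longrightarrow> \<psi> z = ereal (real_of_ereal (\<psi> z))"
    "\<And>z. norm (z - y) < d \<Longrightarrow>
       \<bar>real_of_ereal (\<psi> z) - real_of_ereal (\<psi> y) - g \<bullet> (z - y)\<bar> \<le> e * norm (z - y)"
proof -
  from assms(1) obtain d1 where d1: "0 < d1" "\<And>z. dist z y < d1 \<Longrightarrow> \<bar>\<psi> z\<bar> \<noteq> \<infinity>"
    unfolding gradient_at_def eventually_nhds_metric by blast
  from assms obtain d2 where d2: "0 < d2" "\<And>z. norm (z - y) < d2 \<Longrightarrow>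
       \<bar>real_of_ereal (\<psi> z) - real_of_ereal (\<psi> y) - g \<bullet> (z - y)\<bar> \<le> e * norm (z - y)"
    unfolding gradient_at_def has_derivative_at_alt real_norm_def by blast
  show thesis
    by (rule that[of "min d1 d2"]) (use d1 d2 in \<open>auto simp: dist_norm ereal_real\<close>)
qed

text \<open>Convexity bounds the difference quotients from \<open>y\<close> towards \<open>x\<close>
  by the difference of the two end values, and their limit is the directional derivative
  \<open>g \<bullet> (x - y)\<close>.\<close>

lemma gradient_at_support:
  fixes \<psi> :: "'a::euclidean_space \<Rightarrow> ereal"
  assumes conv: "convex_fun \<psi>" and proper: "proper_fun \<psi>" and grad: "gradient_at \<psi> y g"
  shows "ereal (real_of_ereal (\<psi> y) + g \<bullet> (x - y)) \<le> \<psi> x"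
proof (cases "\<psi> x = \<infinity>")
  case False
  define F where "F z = real_of_ereal (\<psi> z)" for z
  have fin_x: "\<psi> x = ereal (F x)"
    using False proper unfolding F_def proper_fun_def by (cases "\<psi> x") auto
  have fin_y: "\<psi> y = ereal (F y)"
    unfolding F_def by (rule gradient_at_finite[OF grad])
  have below: "F (y + t *\<^sub>R (x - y)) \<le> F y + t * (F x - F y)" if "0 \<le> t" "t \<le> 1" for t
  proof -
    have "(y, F y) \<in> {(x, r). \<psi> x \<le> ereal r}" "(x, F x) \<in> {(x, r). \<psi> x \<le> ereal r}"
      using fin_x fin_y by auto
    then have "(1 - t) *\<^sub>R (y, F y) + t *\<^sub>R (x, F x) \<in> {(x, r). \<psi> x \<le> ereal r}"
      by (rule convexD_alt[OF conv[unfolded convex_fun_def]]) (rule that)+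
    then have "\<psi> ((1 - t) *\<^sub>R y + t *\<^sub>R x) \<le> ereal ((1 - t) * F y + t * F x)"
      by simp
    moreover have "(1 - t) *\<^sub>R y + t *\<^sub>R x = y + t *\<^sub>R (x - y)"
      by (simp add: algebra_simps)
    moreover have "(1 - t) * F y + t * F x = F y + t * (F x - F y)"
      by (simp add: algebra_simps)
    ultimately have "\<psi> (y + t *\<^sub>R (x - y)) \<le> ereal (F y + t * (F x - F y))"
      by simp
    \<comment> \<open>An upper bound survives \<open>real_of_ereal\<close> only away from
      -\<infinity>, where the default value 0 would be returned.\<close>
    moreover have "\<psi> (y + t *\<^sub>R (x - y)) \<noteq> -\<infinity>"
      using proper unfolding proper_fun_def by blast
    ultimately show ?thesis
      unfolding F_def by (cases "\<psi> (y + t *\<^sub>R (x - y))") auto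
  qed
  have "(F has_derivative (\<lambda>h. g \<bullet> h)) (at (y + 0 *\<^sub>R (x - y)))"
    using grad unfolding gradient_at_def F_def by simp
  then have "((\<lambda>t. F (y + t *\<^sub>R (x - y))) has_derivative (\<lambda>t. g \<bullet> (t *\<^sub>R (x - y)))) (at 0)"
    by (rule has_derivative_compose[rotated]) (auto intro!: derivative_eq_intros)
  then have "((\<lambda>t. F (y + t *\<^sub>R (x - y))) has_real_derivative g \<bullet> (x - y)) (at 0)"
    unfolding has_field_derivative_def by (rule has_derivative_eq_rhs) (auto simp: mult.commute)
  then have "(\<lambda>t. (F (y + (0 + t) *\<^sub>R (x - y)) - F (y + 0 *\<^sub>R (x - y))) / t) \<midarrow>0\<rightarrow> g \<bullet> (x - y)"
    unfolding DERIV_def by simp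
  then have "((\<lambda>t. (F (y + t *\<^sub>R (x - y)) - F y) / t) \<longlongrightarrow> g \<bullet> (x - y)) (at_right 0)"
    by (simp add: filterlim_at_split)
  moreover have "\<forall>\<^sub>F t in at_right 0. (F (y + t *\<^sub>R (x - y)) - F y) / t \<le> F x - F y"
  proof (rule eventually_at_rightI[of 0 1])
    fix t :: real assume "t \<in> {0<..<1}"
    then show "(F (y + t *\<^sub>R (x - y)) - F y) / t \<le> F x - F y"
      using below[of t] by (simp add: field_simps)
  qed simp
  ultimately have "g \<bullet> (x - y) \<le> F x - F y"
    by (rule tendsto_upperbound) simp
  then have "ereal (F y + g \<bullet> (x - y)) \<le> ereal (F x)"
    by simp
  then show ?thesis
    unfolding fin_x[symmetric] by (simp only: F_def)
qed simp

text \<open>Subtracting an affine minorant that touches at \<open>y\<close> leaves a local minimum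
  there, so the differential \<open>g - a\<close> vanishes. This turns contact of planes into
  equality of gradients.\<close>

lemma gradient_at_unique_slope:
  fixes \<psi> :: "'a::euclidean_space \<Rightarrow> ereal"
  assumes grad: "gradient_at \<psi> y g"
    and slope: "\<And>x. ereal (real_of_ereal (\<psi> y) + a \<bullet> (x - y)) \<le> \<psi> x"
  shows "a = g"
proof -
  define F where "F z = real_of_ereal (\<psi> z)" for z
  obtain d where d: "0 < d" "\<And>z. norm (z - y) < d \<Longrightarrow> \<psi> z = ereal (F z)"
    by (rule gradient_at_first_order[OF grad zero_less_one]) (auto simp: F_def)
  have "((\<lambda>z. F z - a \<bullet> z) has_derivative (\<lambda>h. g \<bullet> h - a \<bullet> h)) (at y)"
    using grad unfolding gradient_at_def F_def by (auto intro!: derivative_eq_intros)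
  moreover have "F y - a \<bullet> y \<le> F z - a \<bullet> z" if "z \<in> ball y d" for z
  proof -
    have "ereal (F y + a \<bullet> (z - y)) \<le> ereal (F z)"
      using slope[of z] d(2)[of z] that by (simp add: F_def dist_norm norm_minus_commute)
    then show ?thesis by (simp add: inner_diff_right)
  qed
  ultimately have "(\<lambda>h. g \<bullet> h - a \<bullet> h) = (\<lambda>h. 0)"
    by (intro differential_zero_maxmin[of y "ball y d" "\<lambda>z. F z - a \<bullet> z"]) (use d in auto)
  then have "(g - a) \<bullet> (g - a) = 0"
    by (metis inner_diff_left)
  then show ?thesis by simp
qed

text \<open>A convex function lying close to its tangent plane on a ball has all its slopes on a
  smaller concentric ball close to the slope at the centre.\<close>
lemma continuous_on_gradient:
  fixes \<psi> :: "'a::euclidean_space \<Rightarrow> ereal"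
  assumes conv: "convex_fun \<psi>" and proper: "proper_fun \<psi>"
    and grad: "\<And>y. y \<in> S \<Longrightarrow> gradient_at \<psi> y (v y)"
  shows "continuous_on S v"
proof (unfold continuous_on_iff, intro ballI allI impI)
  fix y and e :: real assume y: "y \<in> S" and "0 < e"
  define F where "F z = real_of_ereal (\<psi> z)" for z
  have "0 < e / 4" using \<open>0 < e\<close> by simp
  then obtain d where d: "0 < d" "\<And>z. norm (z - y) < d \<Longrightarrow> \<psi> z = ereal (F z)"
    "\<And>z. norm (z - y) < d \<Longrightarrow> \<bar>F z - F y - v y \<bullet> (z - y)\<bar> \<le> e / 4 * norm (z - y)"
    unfolding F_def by (rule gradient_at_first_order[OF grad[OF y]]) blast
  have "dist (v x) (v y) < e" if x: "x \<in> S" "dist x y < d / 3" for x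
  proof (cases "v x = v y")
    case False
    define w where "w = v x - v y"
    \<comment> \<open>In the direction \<open>w\<close> the plane at \<open>x\<close> outgrows the
      tangent plane at \<open>y\<close> at rate \<open>norm w\<close>. A step of length
      \<open>d / 3\<close> keeps \<open>z\<close> within \<open>2 * d / 3\<close> of
      \<open>y\<close>; the two first-order errors add up to \<open>e / 4 * d\<close>, whence
      \<open>norm w\<close> is at most \<open>3 * e / 4\<close>.\<close>
    define z where "z = x + (d / 3 / norm w) *\<^sub>R w"
    have w: "0 < norm w" using False by (simp add: w_def)
    have zx: "norm (z - x) = d / 3" using w \<open>0 < d\<close> by (simp add: z_def)
    have xy: "norm (x - y) < d / 3" using x by (simp add: dist_norm)
    have zy: "norm (z - y) \<le> 2 * d / 3"
      using norm_triangle_ineq[of "z - x" "x - y"] zx xy by simp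
    then have zy': "norm (z - y) < d" using \<open>0 < d\<close> by linarith
    have "ereal (F x + v x \<bullet> (z - x)) \<le> \<psi> z"
      unfolding F_def by (rule gradient_at_support[OF conv proper grad[OF x(1)]])
    then have "F x + v x \<bullet> (z - x) \<le> F z"
      using d(2)[OF zy'] by simp
    moreover have "\<bar>F z - F y - v y \<bullet> (z - y)\<bar> \<le> e / 4 * (2 * d / 3)"
      using zy \<open>0 < e\<close> by (intro order_trans[OF d(3)[OF zy']] mult_left_mono) auto
    moreover have "\<bar>F x - F y - v y \<bullet> (x - y)\<bar> \<le> e / 4 * (d / 3)"
      using xy \<open>0 < e\<close> \<open>0 < d\<close> by (intro order_trans[OF d(3)] mult_left_mono) auto
    moreover have "v y \<bullet> (z - y) - v y \<bullet> (x - y) = v y \<bullet> (z - x)"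
      by (simp add: inner_diff_right)
    ultimately have "v x \<bullet> (z - x) - v y \<bullet> (z - x) \<le> e / 4 * d"
      by (simp add: abs_le_iff) argo
    then have "w \<bullet> (z - x) \<le> e / 4 * d"
      unfolding w_def inner_diff_left .
    moreover have "w \<bullet> (z - x) = d / 3 * norm w"
      using w by (simp add: z_def power2_norm_eq_inner[symmetric] power2_eq_square)
    ultimately have "norm w \<le> 3 * e / 4"
      using \<open>0 < d\<close> by (simp add: field_simps)
    then show ?thesis
      using \<open>0 < e\<close> by (simp add: w_def dist_norm)
  qed (use \<open>0 < e\<close> in simp)
  then show "\<exists>d>0. \<forall>x\<in>S. dist x y < d \<longrightarrow> dist (v x) (v y) < e"
    using \<open>0 < d\<close> by (intro exI[of _ "d / 3"]) auto
qed

lemma continuous_on_real_of_gradient: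
  assumes "\<And>y. y \<in> S \<Longrightarrow> gradient_at \<psi> y (v y)"
  shows "continuous_on S (\<lambda>y. real_of_ereal (\<psi> y))"
  using assms unfolding gradient_at_def
  by (meson continuous_at_imp_continuous_on has_derivative_continuous)

section \<open>Gradients with countable fibres\<close>

text \<open>Moving each point a fraction \<open>t\<close> of the way to the centre \<open>c i\<close> selected by its slope
  is injective: a collision of two points would make the sum of two nonnegative
  monotonicity terms vanish, which forces a tie between the selected centres.\<close>
lemma shrink_towards_finite:
  fixes v :: "'a::euclidean_space \<Rightarrow> 'a" and c :: "nat \<Rightarrow> 'a" and q :: "nat \<Rightarrow> real"
  assumes A: "compact A" and cont: "continuous_on A v"
    and mono: "\<And>x y. x \<in> A \<Longrightarrow> y \<in> A \<Longrightarrow> 0 \<le> (v x - v y) \<bullet> (x - y)"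
    and t: "0 < t" "t < 1"
  obtains W where "W \<in> sets borel"
    "emeasure lebesgue W = ennreal ((1 - t) ^ DIM('a)) * emeasure lebesgue A"
    "W \<subseteq> {(1 - t) *\<^sub>R y + t *\<^sub>R c i | y i. y \<in> A \<and> i \<le> m \<and>
            (\<forall>j\<le>m. v y \<bullet> c j - q j \<le> v y \<bullet> c i - q i)}"
proof -
  define g where "g i a = a \<bullet> c i - q i" for i a
  \<comment> \<open>Ties for the largest \<open>g i\<close> go to the least index. This makes the
    cells disjoint, and the strict inequality is what a collision between two cells
    contradicts.\<close>
  define C where "C i = {y \<in> A. (\<forall>j\<le>m. g j (v y) \<le> g i (v y)) \<and> (\<forall>j<i. g j (v y) < g i (v y))}" for i
  define \<phi> where "\<phi> i y = (1 - t) *\<^sub>R y + t *\<^sub>R c i" for i y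
  have disjC: "disjoint_family_on C {..m}"
    unfolding disjoint_family_on_def C_def
    by (auto simp: not_less) (meson atMost_iff linorder_neqE_nat not_less)
  have coverC: "(\<Union>i\<le>m. C i) = A"
  proof (intro equalityI subsetI)
    fix y assume y: "y \<in> A"
    define P where "P i \<longleftrightarrow> i \<le> m \<and> (\<forall>j\<le>m. g j (v y) \<le> g i (v y))" for i
    have "Max ((\<lambda>i. g i (v y)) ` {..m}) \<in> (\<lambda>i. g i (v y)) ` {..m}"
      by (rule Max_in) auto
    then obtain i where "i \<le> m" "Max ((\<lambda>i. g i (v y)) ` {..m}) = g i (v y)"
      by (elim imageE) simp
    then have "P i"
      unfolding P_def by (metis Max_ge atMost_iff finite_atMost finite_imageI imageI)
    then have "P (LEAST i. P i)" and least: "\<And>j. j < (LEAST i. P i) \<Longrightarrow> \<not> P j"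
      by (auto intro: LeastI_ex dest: not_less_Least)
    moreover have "g j (v y) < g (LEAST i. P i) (v y)" if "j < (LEAST i. P i)" for j
      using least[OF that] \<open>P (LEAST i. P i)\<close> that unfolding P_def
      by (meson le_trans less_imp_le not_less order_trans)
    ultimately show "y \<in> (\<Union>i\<le>m. C i)"
      using y unfolding C_def P_def by blast
  qed (auto simp: C_def)
  have gcont: "continuous_on A (\<lambda>y. g i (v y))" for i
    unfolding g_def by (intro continuous_intros cont)
  have Cborel: "C i \<in> sets borel" for i
  proof -
    have le: "{y \<in> A. g j (v y) \<le> g i (v y)} \<in> sets borel" for j
      by (intro borel_closed continuous_on_closed_Collect_le gcont compact_imp_closed A)
    have "{y \<in> A. g j (v y) < g i (v y)} = A - {y \<in> A. g i (v y) \<le> g j (v y)}" for j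
      by auto
    moreover have "{y \<in> A. g i (v y) \<le> g j (v y)} \<in> sets borel" for j
      by (intro borel_closed continuous_on_closed_Collect_le gcont compact_imp_closed A)
    ultimately have less: "{y \<in> A. g j (v y) < g i (v y)} \<in> sets borel" for j
      using borel_compact[OF A] by simp
    have "C i = A \<inter> (\<Inter>j\<in>{..m}. {y \<in> A. g j (v y) \<le> g i (v y)}) \<inter>
                  (\<Inter>j\<in>{..<i}. {y \<in> A. g j (v y) < g i (v y)} \<union> - A)"
      unfolding C_def by auto
    moreover have "(\<Inter>j\<in>{..<i}. {y \<in> A. g j (v y) < g i (v y)} \<union> - A) \<in> sets borel"
      using less borel_compact[OF A]
      by (cases "i = 0") (auto intro!: sets.finite_INT)
    ultimately show ?thesis
      using le borel_compact[OF A] by (auto intro!: sets.Int sets.finite_INT)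
  qed
  have \<phi>vimage: "\<phi> i ` S = (\<lambda>z. (1 / (1 - t)) *\<^sub>R (z - t *\<^sub>R c i)) -` S" for i S
  proof (intro equalityI subsetI)
    fix z assume "z \<in> (\<lambda>z. (1 / (1 - t)) *\<^sub>R (z - t *\<^sub>R c i)) -` S"
    then show "z \<in> \<phi> i ` S"
      using t unfolding \<phi>_def
      by (intro image_eqI[of _ _ "(1 / (1 - t)) *\<^sub>R (z - t *\<^sub>R c i)"]) auto
  qed (use t in \<open>auto simp: \<phi>_def\<close>)
  have \<phi>borel: "\<phi> i ` C i \<in> sets borel" for i
  proof -
    have "(\<lambda>z. (1 / (1 - t)) *\<^sub>R (z - t *\<^sub>R c i)) \<in> borel_measurable borel"
      by measurable
    from measurable_sets[OF this Cborel] show ?thesis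
      unfolding \<phi>vimage by simp
  qed
  have "i = j" if "i \<le> m" "j \<le> m" "x \<in> C i" "y \<in> C j" "\<phi> i x = \<phi> j y" for i j x y
  proof -
    have xy: "x \<in> A" "y \<in> A" using that by (auto simp: C_def)
    have "(1 - t) *\<^sub>R (x - y) + t *\<^sub>R (c i - c j) = 0"
      using that(5) by (simp add: \<phi>_def algebra_simps)
    then have "(v x - v y) \<bullet> ((1 - t) *\<^sub>R (x - y) + t *\<^sub>R (c i - c j)) = 0"
      by simp
    then have "(1 - t) * ((v x - v y) \<bullet> (x - y)) + t * ((v x - v y) \<bullet> (c i - c j)) = 0"
      by (simp only: inner_add_right inner_scaleR_right)
    moreover have "0 \<le> (1 - t) * ((v x - v y) \<bullet> (x - y))"
      using t mono[OF xy] by simp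
    ultimately have "t * ((v x - v y) \<bullet> (c i - c j)) \<le> 0"
      by linarith
    then have "(v x - v y) \<bullet> (c i - c j) \<le> 0"
      using t by (simp add: mult_le_0_iff)
    then have "g i (v x) - g j (v x) + (g j (v y) - g i (v y)) \<le> 0"
      by (simp add: g_def inner_diff_left inner_diff_right)
    moreover have "g j (v x) \<le> g i (v x)" "g i (v y) \<le> g j (v y)"
      using that by (auto simp: C_def)
    ultimately have "g i (v x) = g j (v x)" "g i (v y) = g j (v y)"
      by linarith+
    then show "i = j"
      using that(3,4) unfolding C_def by (cases i j rule: linorder_cases) auto
  qed
  then have disj: "disjoint_family_on (\<lambda>i. \<phi> i ` C i) {..m}"
    unfolding disjoint_family_on_def by blast
  define W where "W = (\<Union>i\<le>m. \<phi> i ` C i)"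
  have scale: "emeasure lebesgue (\<phi> i ` S) = ennreal ((1 - t) ^ DIM('a)) * emeasure lebesgue S" for i S
    unfolding \<phi>_def using t by (simp add: emeasure_lebesgue_affine)
  show thesis
  proof (rule that[of W])
    show "W \<in> sets borel"
      unfolding W_def using \<phi>borel by auto
    have "emeasure lebesgue W = (\<Sum>i\<le>m. emeasure lebesgue (\<phi> i ` C i))"
      unfolding W_def using \<phi>borel by (intro sum_emeasure[symmetric] disj) auto
    also have "\<dots> = ennreal ((1 - t) ^ DIM('a)) * (\<Sum>i\<le>m. emeasure lebesgue (C i))"
      by (simp add: scale sum_distrib_left)
    also have "(\<Sum>i\<le>m. emeasure lebesgue (C i)) = emeasure lebesgue A"
      unfolding coverC[symmetric] using Cborel by (intro sum_emeasure disjC) auto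
    finally show "emeasure lebesgue W = ennreal ((1 - t) ^ DIM('a)) * emeasure lebesgue A" .
    show "W \<subseteq> {(1 - t) *\<^sub>R y + t *\<^sub>R c i | y i. y \<in> A \<and> i \<le> m \<and>
            (\<forall>j\<le>m. v y \<bullet> c j - q j \<le> v y \<bullet> c i - q i)}"
      unfolding W_def \<phi>_def C_def g_def by blast
  qed
qed

section \<open>Segments inside the fibres of a gradient\<close>

text \<open>This isolates what the fibre argument uses of a convex function: finite values on
  \<open>Y\<close> only. \<open>contact\<close> expresses differentiability; an arbitrary selection
  of subgradients satisfies \<open>support\<close> but may violate \<open>contact\<close>.\<close>

locale supporting_slopes =
  fixes Y :: "'a::euclidean_space set" and f :: "'a \<Rightarrow> real" and v :: "'a \<Rightarrow> 'a"
  assumes support: "x \<in> Y \<Longrightarrow> y \<in> Y \<Longrightarrow> f y + v y \<bullet> (x - y) \<le> f x"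
    and contact: "x \<in> Y \<Longrightarrow> y \<in> Y \<Longrightarrow> f x = f y + v y \<bullet> (x - y) \<Longrightarrow> v x = v y"
    and cont_f: "continuous_on Y f" and cont_v: "continuous_on Y v"
begin

lemma monotone:
  assumes "x \<in> Y" "y \<in> Y"
  shows "0 \<le> (v x - v y) \<bullet> (x - y)"
  using support[OF assms] support[OF assms(2,1)] by (simp add: inner_diff_left inner_diff_right)

definition fibre_segments :: "'a set \<Rightarrow> 'a set \<Rightarrow> real \<Rightarrow> 'a set" where
  "fibre_segments A L t = {(1 - t) *\<^sub>R y + t *\<^sub>R c | y c. y \<in> A \<and> c \<in> L \<and> v y = v c}"

lemma compact_fibre_pairs:
  assumes "compact A" "compact L" "A \<subseteq> Y" "L \<subseteq> Y"
  shows "compact {p \<in> A \<times> L. v (fst p) = v (snd p)}"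
proof -
  have "continuous_on (A \<times> L) (\<lambda>p. v (fst p) - v (snd p))"
    using assms by (intro continuous_intros continuous_on_compose2[OF cont_v]) auto
  then have "closed {p \<in> A \<times> L. v (fst p) - v (snd p) = 0}"
    using assms by (intro continuous_closed_preimage_constant compact_imp_closed compact_Times)
  then have "compact ((A \<times> L) \<inter> {p \<in> A \<times> L. v (fst p) - v (snd p) = 0})"
    using assms by (intro compact_Int_closed compact_Times)
  moreover have "(A \<times> L) \<inter> {p \<in> A \<times> L. v (fst p) - v (snd p) = 0} = {p \<in> A \<times> L. v (fst p) = v (snd p)}"
    by auto
  ultimately show ?thesis by simp
qed

lemma fibre_segments_image:
  "fibre_segments A L t = (\<lambda>p. (1 - t) *\<^sub>R fst p + t *\<^sub>R snd p) ` {p \<in> A \<times> L. v (fst p) = v (snd p)}"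
  unfolding fibre_segments_def by force

lemma compact_fibre_segments:
  assumes "compact A" "compact L" "A \<subseteq> Y" "L \<subseteq> Y"
  shows "compact (fibre_segments A L t)"
  unfolding fibre_segments_image
  by (intro compact_continuous_image continuous_intros compact_fibre_pairs assms)

text \<open>For a dense sequence \<open>c\<close> in \<open>L\<close>, the best among the centres \<open>c 0, \<dots>, c m\<close> for the
  slope \<open>v y\<close> approaches the fibre of \<open>v\<close> through \<open>y\<close>, uniformly in \<open>y\<close>.\<close>
lemma emeasure_fibre_segments:
  assumes A: "compact A" "A \<subseteq> Y" and L: "compact L" "L \<subseteq> Y"
    and hit: "v ` A \<subseteq> v ` L" and t: "0 < t" "t < 1"
  shows "ennreal ((1 - t) ^ DIM('a)) * emeasure lebesgue A \<le> emeasure lebesgue (fibre_segments A L t)"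
proof (cases "A = {}")
  case False
  then have "L \<noteq> {}" using hit by auto
  define \<Phi> where "\<Phi> = fibre_segments A L t"
  have \<Phi>: "compact \<Phi>" unfolding \<Phi>_def using A L by (intro compact_fibre_segments)
  obtain D where D: "countable D" "D \<subseteq> L" "L \<subseteq> closure D"
    using separable by blast
  have "D \<noteq> {}" using D(3) \<open>L \<noteq> {}\<close> by auto
  define c where "c = from_nat_into D"
  have rc: "range c = D" unfolding c_def using \<open>D \<noteq> {}\<close> D(1) by (rule range_from_nat_into)
  have cL: "c i \<in> L" for i using rc D(2) by auto
  show ?thesis
  proof (rule ennreal_le_epsilon)
    fix e :: real assume "0 < e"
    \<comment> \<open>Up to the error \<open>e\<close> it suffices to place a set of the required
      measure inside an open neighbourhood \<open>U\<close> of \<open>\<Phi>\<close>, which finitely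
      many centres achieve.\<close>
    have "\<Phi> \<in> sets lebesgue" using \<Phi> by (simp add: borel_compact)
    then obtain U where U: "open U" "\<Phi> \<subseteq> U" "emeasure lebesgue (U - \<Phi>) < ennreal e"
      by (rule sets_lebesgue_outer_open[OF _ \<open>0 < e\<close>])
    define h where "h p = (1 - t) *\<^sub>R fst p + t *\<^sub>R snd p" for p :: "'a \<times> 'a"
    define Z where "Z = (A \<times> L) \<inter> h -` (- U)"
    have "continuous_on (A \<times> L) h" unfolding h_def by (intro continuous_intros)
    then have Z: "compact Z"
      unfolding Z_def using A L U(1)
      by (intro compact_Int_closed[of "A \<times> L" "(A \<times> L) \<inter> h -` (- U)", unfolded Int_left_absorb]
          compact_Times continuous_closed_preimage compact_imp_closed closed_Compl)
    define better where "better j p \<longleftrightarrow> v (fst p) \<bullet> snd p - f (snd p) < v (fst p) \<bullet> c j - f (c j)" for j p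
    \<comment> \<open>If no dense centre beats \<open>l\<close>, then by continuity neither does a
      true partner \<open>y'\<close> of \<open>y\<close>. So \<open>l\<close> lies on the supporting
      plane at \<open>y'\<close> and \<open>contact\<close> puts it in the fibre of
      \<open>y\<close>; but then \<open>h p\<close> belongs to \<open>\<Phi>\<close>, hence to
      \<open>U\<close>.\<close>
    have ex: "\<exists>j. better j p" if "p \<in> Z" for p
    proof (rule ccontr)
      assume no: "\<nexists>j. better j p"
      obtain y l where pyl: "p = (y, l)" by (cases p)
      then have p: "p = (y, l)" "y \<in> A" "l \<in> L" "h p \<notin> U"
        using that unfolding Z_def by auto
      obtain y' where y': "y' \<in> L" "v y' = v y" using hit p(2) by (metis imageE image_subset_iff)
      have "continuous_on L (\<lambda>x. v y \<bullet> x - f x)"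
        using L by (intro continuous_intros continuous_on_subset[OF cont_f])
      moreover have "v y \<bullet> x - f x \<le> v y \<bullet> l - f l" if "x \<in> D" for x
        using no that rc unfolding better_def p(1) by (metis fst_conv not_less rangeE snd_conv)
      moreover have "closure D \<subseteq> L"
        using D(2) L by (meson closure_minimal compact_imp_closed)
      ultimately have "v y \<bullet> y' - f y' \<le> v y \<bullet> l - f l"
        using continuous_le_on_closure[of D "\<lambda>x. v y \<bullet> x - f x" y' "v y \<bullet> l - f l"] D(3) y'(1)
        by (meson continuous_on_subset subsetD)
      moreover have "f y' + v y' \<bullet> (l - y') \<le> f l"
        using support p(3) y'(1) L(2) by blast
      ultimately have "f l = f y' + v y' \<bullet> (l - y')"
        unfolding y'(2) inner_diff_right by linarith
      then have "v l = v y'"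
        using contact p(3) y'(1) L(2) by blast
      then have "h p \<in> \<Phi>"
        using p y'(2) unfolding \<Phi>_def fibre_segments_def h_def mem_Collect_eq
        by (intro exI[of _ y] exI[of _ l]) auto
      then show False using p(4) U(2) by auto
    qed
    have "\<exists>m. \<forall>p\<in>Z. \<exists>j\<le>m. better j p"
    proof -
      have "continuous_on (A \<times> L) (\<lambda>p. v (fst p) \<bullet> snd p - f (snd p))"
           "continuous_on (A \<times> L) (\<lambda>p. v (fst p) \<bullet> c j - f (c j))" for j
        using A L by (auto intro!: continuous_intros continuous_on_compose2[OF cont_v] continuous_on_compose2[OF cont_f])
      then have cZ: "continuous_on Z (\<lambda>p. v (fst p) \<bullet> snd p - f (snd p))"
           "continuous_on Z (\<lambda>p. v (fst p) \<bullet> c j - f (c j))" for j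
        by (auto simp: Z_def intro: continuous_on_subset)
      have "openin (top_of_set Z) {p \<in> Z. better j p}" for j
      proof -
        have "continuous_on Z (\<lambda>p. (v (fst p) \<bullet> c j - f (c j)) - (v (fst p) \<bullet> snd p - f (snd p)))"
          by (intro continuous_on_diff cZ)
        then have "openin (top_of_set Z) (Z \<inter> (\<lambda>p. (v (fst p) \<bullet> c j - f (c j)) - (v (fst p) \<bullet> snd p - f (snd p))) -` {0<..})"
          by (rule continuous_openin_preimage_gen) simp
        moreover have "Z \<inter> (\<lambda>p. (v (fst p) \<bullet> c j - f (c j)) - (v (fst p) \<bullet> snd p - f (snd p))) -` {0<..} = {p \<in> Z. better j p}"
          unfolding better_def by auto
        ultimately show ?thesis by simp
      qed
      then obtain O' where O': "\<And>j. open (O' j)" "\<And>j. {p \<in> Z. better j p} = Z \<inter> O' j"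
        unfolding openin_open by metis
      have "Z \<subseteq> (\<Union>j\<in>UNIV. O' j)" using ex O'(2) by blast
      then obtain J where J: "finite J" "Z \<subseteq> (\<Union>j\<in>J. O' j)"
        using compactE_image[OF Z, of UNIV O'] O'(1) by (metis subset_UNIV)
      show ?thesis
      proof (rule exI[of _ "Max J"], rule ballI)
        fix p assume "p \<in> Z"
        then obtain j where "j \<in> J" "better j p" using J(2) O'(2) by blast
        then show "\<exists>j\<le>Max J. better j p" using J(1) by (metis Max_ge)
      qed
    qed
    then obtain m where m: "\<And>p. p \<in> Z \<Longrightarrow> \<exists>j\<le>m. better j p" by blast
    obtain W where W: "W \<in> sets borel"
      "emeasure lebesgue W = ennreal ((1 - t) ^ DIM('a)) * emeasure lebesgue A"
      "W \<subseteq> {(1 - t) *\<^sub>R y + t *\<^sub>R c i | y i. y \<in> A \<and> i \<le> m \<and>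
            (\<forall>j\<le>m. v y \<bullet> c j - f (c j) \<le> v y \<bullet> c i - f (c i))}"
    proof (rule shrink_towards_finite[OF A(1) continuous_on_subset[OF cont_v A(2)]])
      show "0 \<le> (v x - v y) \<bullet> (x - y)" if "x \<in> A" "y \<in> A" for x y
        using monotone that A(2) by blast
    qed (use t in auto)
    \<comment> \<open>A centre that is best among the first \<open>m + 1\<close> is not beaten by
      any of them, so its pair with \<open>y\<close> avoids \<open>Z\<close>.\<close>
    have "W \<subseteq> U"
    proof
      fix w assume "w \<in> W"
      then obtain y i where w: "w = h (y, c i)" "y \<in> A"
        and best: "\<forall>j\<le>m. v y \<bullet> c j - f (c j) \<le> v y \<bullet> c i - f (c i)"
        using W(3) unfolding h_def by auto
      have "(y, c i) \<notin> Z"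
        using m[of "(y, c i)"] best unfolding better_def by (auto simp: not_less[symmetric])
      then show "w \<in> U" using w cL unfolding Z_def by auto
    qed
    then have "emeasure lebesgue W \<le> emeasure lebesgue U"
      using U(1) by (intro emeasure_mono) auto
    also have "U = \<Phi> \<union> (U - \<Phi>)" using U(2) by auto
    also have "emeasure lebesgue (\<Phi> \<union> (U - \<Phi>)) \<le> emeasure lebesgue \<Phi> + emeasure lebesgue (U - \<Phi>)"
      using \<open>\<Phi> \<in> sets lebesgue\<close> U(1) by (intro emeasure_subadditive) auto
    also have "\<dots> \<le> emeasure lebesgue \<Phi> + ennreal e"
      using U(3) by (intro add_left_mono) simp
    finally show "ennreal ((1 - t) ^ DIM('a)) * emeasure lebesgue A
        \<le> emeasure lebesgue (fibre_segments A L t) + ennreal e"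
      unfolding W(2) \<Phi>_def .
  qed
qed (auto simp: fibre_segments_def)

text \<open>Two segments of fibres that cross belong to the same fibre, as their supporting planes
  agree at the crossing point and hence along both segments.\<close>
lemma crossing_fibre_segments:
  assumes Y: "y \<in> Y" "c \<in> Y" "y' \<in> Y" "c' \<in> Y"
    and fib: "v y = v c" "v y' = v c'" and t: "0 \<le> t" "t < 1" "0 \<le> t'" "t' < 1"
    and eq: "(1 - t) *\<^sub>R y + t *\<^sub>R c = (1 - t') *\<^sub>R y' + t' *\<^sub>R c'"
  shows "v y = v y'"
proof -
  define pl where "pl x z = f x + v x \<bullet> (z - x)" for x z
  have le: "pl x z \<le> f z" if "x \<in> Y" "z \<in> Y" for x z
    unfolding pl_def by (rule support[OF that(2,1)])
  have aff: "pl x ((1 - t) *\<^sub>R a + t *\<^sub>R b) = (1 - t) * pl x a + t * pl x b" for x a b t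
    unfolding pl_def by (simp add: inner_diff_right inner_add_right algebra_simps)
  have same: "pl x z = f z" if "x \<in> Y" "z \<in> Y" "v x = v z" for x z
  proof -
    have "f x + v x \<bullet> (z - x) \<le> f z" "f z + v z \<bullet> (x - z) \<le> f x"
      using support[OF that(2,1)] support[OF that(1,2)] .
    then show ?thesis
      unfolding pl_def that(3) inner_diff_right by linarith
  qed
  define z where "z = (1 - t) *\<^sub>R y + t *\<^sub>R c"
  have z': "z = (1 - t') *\<^sub>R y' + t' *\<^sub>R c'" using eq by (simp add: z_def)
  have "pl y z = (1 - t) * f y + t * f c"
    unfolding z_def aff using same Y fib by simp
  moreover have "pl y' z = (1 - t) * pl y' y + t * pl y' c"
    unfolding z_def aff ..
  moreover have "pl y' z = (1 - t') * f y' + t' * f c'"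
    unfolding z' aff using same Y fib by simp
  moreover have "pl y z = (1 - t') * pl y y' + t' * pl y c'"
    unfolding z' aff ..
  moreover have "(1 - t) * pl y' y \<le> (1 - t) * f y" "t * pl y' c \<le> t * f c"
    "(1 - t') * pl y y' \<le> (1 - t') * f y'" "t' * pl y c' \<le> t' * f c'"
    using t le Y by (auto intro!: mult_left_mono)
  \<comment> \<open>Adding the values of both planes at \<open>z\<close>, computed along either
    segment, shows that the four inequalities sum to an equality; so each of them is one.\<close>
  ultimately have "(1 - t) * pl y' y = (1 - t) * f y"
    by linarith
  then have "f y = f y' + v y' \<bullet> (y - y')"
    using t by (simp add: pl_def)
  then show ?thesis by (rule contact[OF Y(1,3)])
qed

text \<open>The segments joining \<open>A\<close> to \<open>L\<close> inside fibres fill, at every time \<open>t \<le> 1/2\<close>, a set of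
  measure at least a fixed multiple of that of \<open>A\<close>, but each point lies on these segments for
  only countably many times; Fubini makes the two incompatible.\<close>
lemma emeasure_countable_fibres_eq_0:
  assumes A: "compact A" "A \<subseteq> Y" and L: "compact L" "L \<subseteq> Y" and disj: "A \<inter> L = {}"
    and hit: "v ` A \<subseteq> v ` L"
    and ctbl: "\<And>a. countable {y \<in> A. v y = a}" "\<And>a. countable {y \<in> L. v y = a}"
  shows "emeasure lebesgue A = 0"
proof -
  \<comment> \<open>The time interval may be any nondegenerate compact one inside (0, 1); here 1 - t
    is at least 1/2 throughout. Compactness makes \<open>E\<close> Borel, as Fubini
    requires.\<close>
  define E where "E = (\<lambda>(t, p). (t, (1 - t) *\<^sub>R fst p + t *\<^sub>R snd p)) `
    ({1/4..1/2::real} \<times> {p \<in> A \<times> L. v (fst p) = v (snd p)})"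
  have "compact E"
    unfolding E_def case_prod_unfold using A L
    by (intro compact_continuous_image continuous_intros compact_Times compact_fibre_pairs) auto
  then have E: "E \<in> sets (lborel \<Otimes>\<^sub>M lborel)"
    unfolding lborel_prod by (simp add: borel_compact)
  have slice: "Pair t -` E = fibre_segments A L t" if "t \<in> {1/4..1/2}" for t
    unfolding E_def fibre_segments_def using that by (auto simp: image_iff; blast)
  have "countable {t. (t, z) \<in> E}" for z
  proof (cases "{t. (t, z) \<in> E} = {}")
    case False
    then obtain t0 y0 c0 where t0: "t0 \<in> {1/4..1/2}" "y0 \<in> A" "c0 \<in> L" "v y0 = v c0"
        "z = (1 - t0) *\<^sub>R y0 + t0 *\<^sub>R c0"
      unfolding E_def by auto
    define P where "P = {y \<in> A. v y = v y0} \<times> {c \<in> L. v c = v y0}"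
    \<comment> \<open>A pair with \<open>y \<noteq> c\<close> passes through \<open>z\<close> only
      once, and all pairs through \<open>z\<close> lie in the fibre of \<open>y0\<close>; so the
      times are indexed by the countable set \<open>P\<close>.\<close>
    define time where "time p = (THE t. z = (1 - t) *\<^sub>R fst p + t *\<^sub>R snd p)" for p
    have "{t. (t, z) \<in> E} \<subseteq> time ` P"
    proof
      fix t assume "t \<in> {t. (t, z) \<in> E}"
      then obtain y c where t: "t \<in> {1/4..1/2}" "y \<in> A" "c \<in> L" "v y = v c"
          "z = (1 - t) *\<^sub>R y + t *\<^sub>R c"
        unfolding E_def by auto
      have "v y = v y0"
        by (rule crossing_fibre_segments[of y c y0 c0 t t0]) (use t t0 A(2) L(2) in auto)
      then have "(y, c) \<in> P" using t by (simp add: P_def)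
      moreover have "y \<noteq> c" using t disj by auto
      have "time (y, c) = t"
        unfolding time_def
      proof (rule the_equality)
        fix s assume "z = (1 - s) *\<^sub>R fst (y, c) + s *\<^sub>R snd (y, c)"
        then have "(s - t) *\<^sub>R (y - c) = 0" using t(5) by (simp add: algebra_simps)
        then show "s = t" using \<open>y \<noteq> c\<close> by simp
      qed (use t in simp)
      ultimately show "t \<in> time ` P" by (metis image_eqI)
    qed
    moreover have "countable P" unfolding P_def using ctbl by auto
    ultimately show ?thesis by (meson countable_image countable_subset)
  qed simp
  then have null: "emeasure lborel ((\<lambda>t. (t, z)) -` E) = 0" for z
    by (simp add: vimage_def emeasure_lborel_countable)
  interpret lborel_pair: pair_sigma_finite "lborel :: real measure" "lborel :: 'a measure" ..
  have "emeasure (lborel \<Otimes>\<^sub>M lborel) E = 0"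
    unfolding lborel_pair.emeasure_pair_measure_alt2[OF E] null by simp
  then have "(\<integral>\<^sup>+ t. emeasure lborel (Pair t -` E) \<partial>lborel) = 0"
    by (simp add: lborel.emeasure_pair_measure_alt[OF E])
  \<comment> \<open>In the other order of integration, every slice over the interval has at least
    the fixed fraction \<open>(1/2) ^ DIM('a)\<close> of the measure of \<open>A\<close>.\<close>
  moreover have "(\<integral>\<^sup>+ t. ennreal ((1/2) ^ DIM('a)) * emeasure lebesgue A * indicator {1/4..1/2::real} t \<partial>lborel)
     \<le> (\<integral>\<^sup>+ t. emeasure lborel (Pair t -` E) \<partial>lborel)"
  proof (rule nn_integral_mono)
    fix t :: real
    show "ennreal ((1/2) ^ DIM('a)) * emeasure lebesgue A * indicator {1/4..1/2} t
       \<le> emeasure lborel (Pair t -` E)"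
    proof (cases "t \<in> {1/4..1/2}")
      case True
      have "ennreal ((1/2) ^ DIM('a)) * emeasure lebesgue A
          \<le> ennreal ((1 - t) ^ DIM('a)) * emeasure lebesgue A"
        using True by (intro mult_right_mono ennreal_leI power_mono) auto
      also have "\<dots> \<le> emeasure lebesgue (fibre_segments A L t)"
        using True A L hit by (intro emeasure_fibre_segments) auto
      also have "\<dots> = emeasure lborel (fibre_segments A L t)"
        using A L by (simp add: compact_fibre_segments borel_compact)
      finally show ?thesis using True slice by simp
    qed simp
  qed
  ultimately have "(\<integral>\<^sup>+ t. ennreal ((1/2) ^ DIM('a)) * emeasure lebesgue A * indicator {1/4..1/2::real} t \<partial>lborel) = 0"
    by simp
  then have "ennreal ((1/2) ^ DIM('a)) * emeasure lebesgue A * emeasure lborel {1/4..1/2::real} = 0"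
    by (subst (asm) nn_integral_cmult_indicator) auto
  then show ?thesis
    by simp
qed

text \<open>Two distinct points of a fibre are separated by a coordinate, up to sign, with two
  rationals strictly between. This gives countably many pairs of sets to which the null result for
  disjoint compact sets applies.\<close>

lemma null_noninjectivity_points:
  fixes K :: "nat \<Rightarrow> 'a set"
  assumes K: "\<And>j. compact (K j)" "\<And>j. K j \<subseteq> Y"
    and ctbl: "\<And>a. countable {y \<in> \<Union>(range K). v y = a}"
  shows "{y \<in> \<Union>(range K). \<exists>y'\<in>\<Union>(range K). y' \<noteq> y \<and> v y' = v y} \<in> null_sets lebesgue"
proof -
  \<comment> \<open>Two thresholds \<open>p < q\<close> are taken because closed half-spaces with a
    single one could share boundary points; with a gap both sets are compact and disjoint.\<close>
  define A where "A = (\<lambda>(j, l, b, p, q). {y \<in> K j. b \<bullet> y \<le> p \<and> v y \<in> v ` (K l \<inter> {x. q \<le> b \<bullet> x})})"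
  define I where "I = (UNIV :: nat set) \<times> (UNIV :: nat set) \<times> ((Basis \<union> uminus ` Basis) :: 'a set)
      \<times> {(p, q). p \<in> \<rat> \<and> q \<in> \<rat> \<and> (p::real) < q}"
  have "A i \<in> null_sets lebesgue" if "i \<in> I" for i
  proof -
    obtain j l b p q where i: "i = (j, l, b, p, q)"
      by (rule prod_cases5)
    have pq: "p < q"
      using that unfolding I_def i by auto
    define L where "L = K l \<inter> {x. q \<le> b \<bullet> x}"
    have L: "compact L" "L \<subseteq> Y"
      unfolding L_def using K by (auto intro!: compact_Int_closed closed_halfspace_ge)
    have "compact (v ` L)"
      using L by (intro compact_continuous_image continuous_on_subset[OF cont_v])
    then have "closed (v ` L)" by (rule compact_imp_closed)
    then have "closed (K j \<inter> v -` (v ` L))"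
      by (intro continuous_closed_preimage continuous_on_subset[OF cont_v K(2)]
          compact_imp_closed[OF K(1)])
    then have "compact (K j \<inter> (K j \<inter> v -` (v ` L)) \<inter> {x. b \<bullet> x \<le> p})"
      using K by (intro compact_Int_closed closed_halfspace_le)
    moreover have "A i = K j \<inter> (K j \<inter> v -` (v ` L)) \<inter> {x. b \<bullet> x \<le> p}"
      unfolding A_def i L_def by auto
    ultimately have A: "compact (A i)" by simp
    have "emeasure lebesgue (A i) = 0"
    proof (rule emeasure_countable_fibres_eq_0[OF A _ L])
      show "A i \<subseteq> Y" unfolding A_def i using K(2) by auto
      show "A i \<inter> L = {}" unfolding A_def i L_def using pq by auto
      show "v ` A i \<subseteq> v ` L" unfolding A_def i L_def by auto
      show "countable {y \<in> A i. v y = a}" for a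
        by (rule countable_subset[OF _ ctbl[of a]]) (auto simp: A_def i)
      show "countable {y \<in> L. v y = a}" for a
        by (rule countable_subset[OF _ ctbl[of a]]) (auto simp: L_def)
    qed
    then show ?thesis using A by (auto simp: null_sets_def borel_compact)
  qed
  moreover have "countable I"
  proof -
    have "countable {(p, q). p \<in> \<rat> \<and> q \<in> \<rat> \<and> (p::real) < q}"
      by (rule countable_subset[of _ "\<rat> \<times> \<rat>"]) (auto simp: countable_rat)
    then show ?thesis
      unfolding I_def by (intro countable_SIGMA) (auto intro: countable_finite)
  qed
  ultimately have "(\<Union>i\<in>I. A i) \<in> null_sets lebesgue"
    by (intro null_sets_UN') auto
  moreover have "{y \<in> \<Union>(range K). \<exists>y'\<in>\<Union>(range K). y' \<noteq> y \<and> v y' = v y} \<subseteq> (\<Union>i\<in>I. A i)"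
  proof
    fix y assume "y \<in> {y \<in> \<Union>(range K). \<exists>y'\<in>\<Union>(range K). y' \<noteq> y \<and> v y' = v y}"
    then obtain j l y' where y: "y \<in> K j" "y' \<in> K l" "y' \<noteq> y" "v y' = v y" by blast
    then obtain b0 where b0: "b0 \<in> Basis" "b0 \<bullet> y \<noteq> b0 \<bullet> y'"
      by (metis euclidean_eqI inner_commute)
    obtain b where b: "b \<in> Basis \<union> uminus ` Basis" "b \<bullet> y < b \<bullet> y'"
    proof (cases "b0 \<bullet> y < b0 \<bullet> y'")
      case False
      then show thesis using b0 by (intro that[of "- b0"]) auto
    qed (use b0 in \<open>auto intro: that\<close>)
    obtain p where p: "p \<in> \<rat>" "b \<bullet> y < p" "p < b \<bullet> y'"
      using Rats_dense_in_real[OF b(2)] by blast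
    obtain q where q: "q \<in> \<rat>" "p < q" "q < b \<bullet> y'"
      using Rats_dense_in_real[OF p(3)] by blast
    have "(j, l, b, p, q) \<in> I" unfolding I_def using b p q by auto
    moreover have "y \<in> A (j, l, b, p, q)"
      unfolding A_def using y p q by (auto intro!: image_eqI[of _ _ y'])
    ultimately show "y \<in> (\<Union>i\<in>I. A i)" by blast
  qed
  ultimately show ?thesis by (rule null_sets_completion_subset[rotated])
qed

end

section \<open>Inner approximation by compact sets\<close>

text \<open>The hereditary property \<open>P\<close> lets one argument serve plain inner regularity
  and continuity on each piece. Heredity is needed because closed sets are cut by balls to become
  compact.\<close>

lemma sets_lebesgue_compact_exhaustion:
  fixes S :: "'a::euclidean_space set"
  assumes S: "S \<in> sets lebesgue"
    and reg: "\<And>e. 0 < e \<Longrightarrow> \<exists>T. closed T \<and> T \<subseteq> S \<and> emeasure lebesgue (S - T) < ennreal e \<and> P T"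
    and P: "\<And>T T'. P T \<Longrightarrow> T' \<subseteq> T \<Longrightarrow> P T'"
  obtains K :: "nat \<Rightarrow> 'a set" where "\<And>j. compact (K j)" "\<And>j. K j \<subseteq> S" "\<And>j. P (K j)"
    "S - \<Union>(range K) \<in> null_sets lebesgue"
proof -
  have "\<forall>n::nat. \<exists>T. closed T \<and> T \<subseteq> S \<and> emeasure lebesgue (S - T) < ennreal (1 / Suc n) \<and> P T"
    using reg by simp
  then obtain T where T: "\<And>n::nat. closed (T n)" "\<And>n. T n \<subseteq> S"
      "\<And>n. emeasure lebesgue (S - T n) < ennreal (1 / Suc n)" "\<And>n. P (T n)"
    by metis
  define K where "K j = (case prod_decode j of (n, i) \<Rightarrow> T n \<inter> cball 0 (real i))" for j
  have range: "\<Union>(range K) = \<Union>(range T)"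
  proof (intro equalityI subsetI)
    fix x assume "x \<in> \<Union>(range T)"
    then obtain n where n: "x \<in> T n" by blast
    obtain i :: nat where "norm x \<le> real i" using real_arch_simple by blast
    then have "x \<in> K (prod_encode (n, i))" using n by (simp add: K_def)
    then show "x \<in> \<Union>(range K)" by blast
  next
    fix x assume "x \<in> \<Union>(range K)"
    then obtain j where "x \<in> K j" by blast
    then show "x \<in> \<Union>(range T)" by (cases "prod_decode j") (auto simp: K_def)
  qed
  show thesis
  proof (rule that[of K])
    fix j
    show "compact (K j)"
      unfolding K_def using T(1) by (auto split: prod.splits intro!: closed_Int_compact)
    show "K j \<subseteq> S" unfolding K_def using T(2) by (auto split: prod.splits)
    show "P (K j)" unfolding K_def by (cases "prod_decode j") (auto intro: P[OF T(4)])
  next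
    have meas: "S - \<Union>(range T) \<in> sets lebesgue"
      using S T(1) by (intro sets.Diff sets.countable_UN) auto
    have "emeasure lebesgue (S - \<Union>(range T)) \<le> 0"
    proof (rule ennreal_le_epsilon)
      fix e :: real assume "0 < e"
      then obtain n where n: "1 / Suc n < e" using nat_approx_posE by blast
      have "emeasure lebesgue (S - \<Union>(range T)) \<le> emeasure lebesgue (S - T n)"
        using S T(1) by (intro emeasure_mono) auto
      also have "\<dots> \<le> ennreal e"
        using T(3)[of n] n by (meson ennreal_leI less_imp_le order_trans)
      finally show "emeasure lebesgue (S - \<Union>(range T)) \<le> 0 + ennreal e" by simp
    qed
    then show "S - \<Union>(range K) \<in> null_sets lebesgue"
      unfolding range using meas by auto
  qed
qed

lemma sets_lebesgue_sigma_compact: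
  fixes S :: "'a::euclidean_space set"
  assumes "S \<in> sets lebesgue"
  obtains K :: "nat \<Rightarrow> 'a set" where "\<And>j. compact (K j)" "\<And>j. K j \<subseteq> S"
    "S - \<Union>(range K) \<in> null_sets lebesgue"
proof (rule sets_lebesgue_compact_exhaustion[OF assms])
  show "\<exists>T. closed T \<and> T \<subseteq> S \<and> emeasure lebesgue (S - T) < ennreal e \<and> True" if "0 < e" for e
    by (rule sets_lebesgue_inner_closed[OF assms that]) auto
qed (auto intro: that)

text \<open>Over a countable base, the preimage of each base set and its complement in
  \<open>S\<close> are both approximated by closed sets from inside. On the intersection
  \<open>T\<close> these preimages become relatively open.\<close>

lemma Lusin:
  fixes h :: "'a::euclidean_space \<Rightarrow> 'b::second_countable_topology"
  assumes S: "S \<in> sets lebesgue" and h: "\<And>U. open U \<Longrightarrow> {x \<in> S. h x \<in> U} \<in> sets lebesgue"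
    and e: "0 < e"
  obtains T where "closed T" "T \<subseteq> S" "emeasure lebesgue (S - T) < ennreal e" "continuous_on T h"
proof -
  obtain B :: "'b set set" where B: "countable B" "topological_basis B"
    using ex_countable_basis by blast
  have "B \<noteq> {}" using B(2) unfolding topological_basis_def by (metis Union_empty empty_not_UNIV open_UNIV subset_empty)
  define b where "b = from_nat_into B"
  have rb: "range b = B" unfolding b_def using \<open>B \<noteq> {}\<close> B(1) by (rule range_from_nat_into)
  define A where "A n = {x \<in> S. h x \<in> b n}" for n
  have A: "A n \<in> sets lebesgue" "S - A n \<in> sets lebesgue" for n
    using h topological_basis_open[OF B(2)] rb S unfolding A_def by auto
  \<comment> \<open>Each base set costs two errors \<open>r n\<close>; the total is
    \<open>e / 2\<close>, which leaves room for the strict bound by \<open>e\<close>.\<close>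
  define r where "r n = e / 4 * (1/2) ^ Suc n" for n
  have r: "0 < r n" for n using e by (simp add: r_def)
  have "\<exists>F. closed F \<and> F \<subseteq> A n \<and> emeasure lebesgue (A n - F) < ennreal (r n)" for n
    by (rule sets_lebesgue_inner_closed[OF A(1) r]) blast
  then obtain F where F: "\<And>n. closed (F n)" "\<And>n. F n \<subseteq> A n"
      "\<And>n. emeasure lebesgue (A n - F n) < ennreal (r n)"
    by metis
  have "\<exists>H. closed H \<and> H \<subseteq> S - A n \<and> emeasure lebesgue ((S - A n) - H) < ennreal (r n)" for n
    by (rule sets_lebesgue_inner_closed[OF A(2) r]) blast
  then obtain H where H: "\<And>n. closed (H n)" "\<And>n. H n \<subseteq> S - A n"
      "\<And>n. emeasure lebesgue ((S - A n) - H n) < ennreal (r n)"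
    by metis
  define T where "T = (\<Inter>n. F n \<union> H n)"
  have TS: "T \<subseteq> S" using F(2)[of 0] H(2)[of 0] by (auto simp: T_def A_def)
  show thesis
  proof (rule that[OF _ TS])
    show "closed T" unfolding T_def using F(1) H(1) by auto
    define G where "G n = (A n - F n) \<union> ((S - A n) - H n)" for n
    have G: "G n \<in> sets lebesgue" for n
      unfolding G_def by (intro sets.Un sets.Diff A) (simp_all add: borel_closed F(1) H(1))
    have "S - T \<subseteq> (\<Union>n. G n)" by (auto simp: T_def G_def)
    then have "emeasure lebesgue (S - T) \<le> emeasure lebesgue (\<Union>n. G n)"
      using G by (intro emeasure_mono) auto
    also have "\<dots> \<le> (\<Sum>n. emeasure lebesgue (G n))"
      using G by (intro emeasure_subadditive_countably) auto
    also have "\<dots> \<le> (\<Sum>n. ennreal (e / 2 * (1/2) ^ Suc n))"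
    proof (intro suminf_le)
      fix n
      have "emeasure lebesgue (G n) \<le> emeasure lebesgue (A n - F n) + emeasure lebesgue ((S - A n) - H n)"
        unfolding G_def
        by (intro emeasure_subadditive sets.Diff A) (simp_all add: borel_closed F(1) H(1))
      also have "\<dots> \<le> ennreal (r n) + ennreal (r n)"
        using F(3)[of n] H(3)[of n] by (intro add_mono) auto
      also have "\<dots> = ennreal (e / 2 * (1/2) ^ Suc n)"
        using r[of n] by (subst ennreal_plus[symmetric]) (auto simp: r_def)
      finally show "emeasure lebesgue (G n) \<le> ennreal (e / 2 * (1/2) ^ Suc n)" .
    qed auto
    also have "\<dots> = ennreal (e / 2)"
      using sums_mult[OF power_half_series, of "e / 2"] e
      by (intro suminf_ennreal_eq) auto
    also have "\<dots> < ennreal e" using e by (simp add: ennreal_lessI)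
    finally show "emeasure lebesgue (S - T) < ennreal e" .
    have pre: "\<exists>V. open V \<and> T \<inter> h -` b n = V \<inter> T" for n
    proof (intro exI conjI)
      show "open (- H n)" using H(1) by (simp add: open_Compl)
      show "T \<inter> h -` b n = - H n \<inter> T"
      proof -
        have "T \<subseteq> F n \<union> H n" unfolding T_def by blast
        then show ?thesis using F(2)[of n] H(2)[of n] unfolding A_def by auto
      qed
    qed
    show "continuous_on T h"
    proof (unfold continuous_on_open_invariant, intro allI impI)
      fix U :: "'b set" assume "open U"
      then obtain B' where B': "B' \<subseteq> B" "U = \<Union>B'"
        using B(2) unfolding topological_basis_def by blast
      obtain V where V: "\<And>n. open (V n)" "\<And>n. T \<inter> h -` b n = V n \<inter> T"
        using pre by metis
      show "\<exists>A. open A \<and> A \<inter> T = h -` U \<inter> T"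
      proof (intro exI conjI)
        show "open (\<Union>n\<in>{n. b n \<in> B'}. V n)" using V(1) by auto
        show "(\<Union>n\<in>{n. b n \<in> B'}. V n) \<inter> T = h -` U \<inter> T"
        proof (intro equalityI subsetI)
          fix x assume x: "x \<in> h -` U \<inter> T"
          then obtain Q where "Q \<in> B'" "h x \<in> Q" using B'(2) by auto
          moreover then obtain n where "Q = b n" using B'(1) rb by blast
          ultimately show "x \<in> (\<Union>n\<in>{n. b n \<in> B'}. V n) \<inter> T" using x V(2)[of n] by blast
        qed (use V(2) B'(2) in blast)
      qed
    qed
  qed
qed

lemma Lusin_sigma_compact:
  fixes h :: "'a::euclidean_space \<Rightarrow> 'b::second_countable_topology"
  assumes S: "S \<in> sets lebesgue" and h: "\<And>U. open U \<Longrightarrow> {x \<in> S. h x \<in> U} \<in> sets lebesgue"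
  obtains K :: "nat \<Rightarrow> 'a set" where "\<And>j. compact (K j)" "\<And>j. K j \<subseteq> S" "\<And>j. continuous_on (K j) h"
    "S - \<Union>(range K) \<in> null_sets lebesgue"
proof (rule sets_lebesgue_compact_exhaustion[OF S])
  show "\<exists>T. closed T \<and> T \<subseteq> S \<and> emeasure lebesgue (S - T) < ennreal e \<and> continuous_on T h" if "0 < e" for e
    by (rule Lusin[OF S h that]) auto
qed (auto intro: continuous_on_subset that)

section \<open>Level sets of differentiable functions\<close>

text \<open>A weak form of the density theorem. Small translates of a compact set lose little of it;
  if the losses sum to less than its measure, some point survives all the translations.\<close>

lemma positive_measure_translates:
  fixes S :: "'a::euclidean_space set"
  assumes S: "S \<in> sets lebesgue" "S \<notin> null_sets lebesgue"
  obtains p and \<tau> :: "nat \<Rightarrow> real"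
  where "p \<in> S" "\<And>j. 0 < \<tau> j" "\<tau> \<longlonglongrightarrow> 0" "\<And>j. p + \<tau> j *\<^sub>R b \<in> S"
proof -
  obtain K where K: "\<And>j::nat. compact (K j)" "\<And>j. K j \<subseteq> S" "S - \<Union>(range K) \<in> null_sets lebesgue"
    using sets_lebesgue_sigma_compact[OF S(1)] by blast
  have "\<exists>j. emeasure lebesgue (K j) \<noteq> 0"
  proof (rule ccontr)
    assume "\<nexists>j. emeasure lebesgue (K j) \<noteq> 0"
    then have "K j \<in> null_sets lebesgue" for j
      using K(1) by (auto simp: null_sets_def borel_compact)
    then have "(S - \<Union>(range K)) \<union> \<Union>(range K) \<in> null_sets lebesgue"
      using K(3) by (intro null_sets.Un null_sets_UN) auto
    then show False
      using S by (metis K(2) Diff_partition UN_least Un_commute)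
  qed
  then obtain j0 where j0: "emeasure lebesgue (K j0) \<noteq> 0" by blast
  define C where "C = K j0"
  have C: "compact C" "C \<subseteq> S" using K by (auto simp: C_def)
  have Cm: "C \<in> lmeasurable" using C(1) by (rule lmeasurable_compact)
  define m where "m = measure lebesgue C"
  have m: "0 < m"
    using j0 Cm unfolding m_def C_def[symmetric]
    by (metis emeasure_eq_measure2 ennreal_0 zero_less_measure_iff fmeasurableD2 emeasure_eq_ennreal_measure top.not_eq_extremum)
  have ex: "\<exists>t. 0 < t \<and> t < 1 / Suc n \<and> measure lebesgue (C - (\<lambda>x. x - t *\<^sub>R b) ` C) \<le> m / 2 * (1/2) ^ Suc n"
    for n :: nat
  proof -
    define e where "e = m / 2 * (1/2) ^ Suc n"
    have e: "0 < e" using m by (simp add: e_def)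
    obtain U where U: "open U" "C \<subseteq> U" "U - C \<in> lmeasurable" "emeasure lebesgue (U - C) < ennreal e"
      using sets_lebesgue_outer_open[of C e] Cm e by (metis fmeasurableD)
    obtain d where d: "0 < d" "(\<Union>x\<in>C. ball x d) \<subseteq> U"
      using compact_subset_open_imp_ball_epsilon_subset[OF C(1) U(1,2)] by blast
    \<comment> \<open>The first bound keeps the translate within distance \<open>d\<close> of
      \<open>C\<close>, hence in \<open>U\<close>; adding 1 to \<open>norm b\<close> covers
      \<open>b = 0\<close>.\<close>
    define t where "t = min (d / (2 * (norm b + 1))) (1 / (2 * Suc n))"
    have t: "0 < t" "t < 1 / Suc n"
      using d(1) by (auto simp: t_def min_less_iff_disj field_simps add_pos_nonneg)
    have "t * norm b < d"
    proof -
      have "t * norm b \<le> d / (2 * (norm b + 1)) * norm b"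
        by (intro mult_right_mono) (auto simp: t_def)
      also have "\<dots> < d"
        using d(1) by (simp add: field_simps add_pos_nonneg) (smt (verit) mult_nonneg_nonneg norm_ge_zero)
      finally show ?thesis .
    qed
    define Ct where "Ct = (\<lambda>x. x - t *\<^sub>R b) ` C"
    have "Ct \<subseteq> U"
    proof
      fix x assume "x \<in> Ct"
      then obtain y where "y \<in> C" "x = y - t *\<^sub>R b" by (auto simp: Ct_def)
      then have "x \<in> ball y d" using \<open>t * norm b < d\<close> t by (simp add: dist_norm)
      then show "x \<in> U" using d(2) \<open>y \<in> C\<close> by blast
    qed
    have Ctm: "Ct \<in> lmeasurable" "measure lebesgue Ct = m"
      unfolding Ct_def m_def using Cm measurable_translation_subtract measure_translation_subtract by auto
    have Um: "U \<in> lmeasurable"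
      using U(2,3) Cm fmeasurable.Un[of C lebesgue "U - C"] by (simp add: Un_absorb1)
    \<comment> \<open>By translation invariance \<open>Ct\<close> fills as much of \<open>U\<close>
      as \<open>C\<close> does, so what it misses is no larger than the excess of \<open>U\<close>
      over \<open>C\<close>.\<close>
    have "measure lebesgue (C - Ct) \<le> measure lebesgue (U - Ct)"
      using U(2) Um Cm Ctm by (intro measure_mono_fmeasurable) (auto intro: fmeasurableD)
    also have "\<dots> = measure lebesgue U - m"
      using measurable_measure_Diff[of U lebesgue Ct] Um Ctm \<open>Ct \<subseteq> U\<close> by (simp add: fmeasurableD)
    also have "\<dots> = measure lebesgue (U - C)"
      using measurable_measure_Diff[of U lebesgue C] Um Cm U(2) by (simp add: fmeasurableD m_def)
    also have "\<dots> \<le> e"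
      using U(3,4) e by (simp add: emeasure_eq_measure2 ennreal_less_iff)
    finally show ?thesis using t unfolding Ct_def e_def by blast
  qed
  then obtain \<tau> where \<tau>: "\<And>n::nat. 0 < \<tau> n" "\<And>n. \<tau> n < 1 / Suc n"
      "\<And>n. measure lebesgue (C - (\<lambda>x. x - \<tau> n *\<^sub>R b) ` C) \<le> m / 2 * (1/2) ^ Suc n"
    by metis
  define Q where "Q n = C - (\<lambda>x. x - \<tau> n *\<^sub>R b) ` C" for n
  have Qm: "Q n \<in> lmeasurable" for n
    unfolding Q_def using Cm measurable_translation_subtract by (intro fmeasurable.Diff) auto
  have "emeasure lebesgue (\<Union>n. Q n) \<le> (\<Sum>n. emeasure lebesgue (Q n))"
    using Qm by (intro emeasure_subadditive_countably) (auto intro: fmeasurableD)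
  also have "\<dots> \<le> (\<Sum>n. ennreal (m / 2 * (1/2) ^ Suc n))"
    using Qm \<tau>(3) by (intro suminf_le) (auto simp: emeasure_eq_measure2 Q_def[symmetric] intro!: ennreal_leI)
  also have "\<dots> = ennreal (m / 2)"
    using sums_mult[OF power_half_series, of "m / 2"] m by (intro suminf_ennreal_eq) auto
  also have "\<dots> < emeasure lebesgue C"
    using Cm m by (simp add: emeasure_eq_measure2 m_def[symmetric] ennreal_lessI)
  finally have "\<not> C \<subseteq> (\<Union>n. Q n)"
    using Qm by (metis emeasure_mono fmeasurableD leD range_subsetD sets.countable_UN image_subset_iff UNIV_I)
  then obtain p where p: "p \<in> C" "\<And>n. p \<notin> Q n" by blast
  show thesis
  proof (rule that[of p \<tau>])
    show "p \<in> S" using p C by auto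
    show "0 < \<tau> j" for j by (rule \<tau>)
    show "\<tau> \<longlonglongrightarrow> 0"
    proof (rule tendsto_sandwich[of "\<lambda>_. 0" _ _ "\<lambda>n. 1 / Suc n"])
      show "(\<lambda>n. 1 / real (Suc n)) \<longlonglongrightarrow> 0"
        using LIMSEQ_inverse_real_of_nat by (simp add: inverse_eq_divide)
    qed (use \<tau> in \<open>auto intro: less_imp_le eventuallyI\<close>)
    show "p + \<tau> j *\<^sub>R b \<in> S" for j
      using p(1) p(2)[of j] C(2) unfolding Q_def by (auto simp: image_iff)
  qed
qed

text \<open>No implicit function theorem applies, as differentiability is known only at the points
  of \<open>S\<close>. But if \<open>w p \<bullet> b\<close> were nonzero on a set of positive
  measure, some \<open>p\<close> in it would be approached along \<open>b\<close> within the level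
  set, so the derivative there would be 0.\<close>

lemma level_set_null:
  fixes \<delta> :: "'a::euclidean_space \<Rightarrow> real" and w :: "'a \<Rightarrow> 'a"
  assumes S: "S \<in> sets lebesgue" and w: "continuous_on S w"
    and der: "\<And>p. p \<in> S \<Longrightarrow> (\<delta> has_derivative (\<lambda>h. w p \<bullet> h)) (at p)"
    and nz: "\<And>p. p \<in> S \<Longrightarrow> w p \<noteq> 0" and const: "\<And>p. p \<in> S \<Longrightarrow> \<delta> p = k"
  shows "S \<in> null_sets lebesgue"
proof -
  have "{p \<in> S. w p \<bullet> b \<noteq> 0} \<in> null_sets lebesgue" for b
  proof (rule ccontr)
    assume neg: "{p \<in> S. w p \<bullet> b \<noteq> 0} \<notin> null_sets lebesgue"
    have "openin (top_of_set S) (S \<inter> (\<lambda>p. w p \<bullet> b) -` (- {0}))"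
      by (intro continuous_openin_preimage_gen continuous_intros w)
    then have "{p \<in> S. w p \<bullet> b \<noteq> 0} \<in> sets lebesgue"
      using lebesgue_openin[OF _ S] by (simp add: vimage_def Int_def)
    then obtain p \<tau> where p: "p \<in> S" "w p \<bullet> b \<noteq> 0" and \<tau>: "\<And>j::nat. 0 < \<tau> j" "\<tau> \<longlonglongrightarrow> 0"
        "\<And>j. p + \<tau> j *\<^sub>R b \<in> S"
      by (rule positive_measure_translates[OF _ neg, of b]) auto
    have "(\<delta> has_derivative (\<lambda>h. w p \<bullet> h)) (at (p + 0 *\<^sub>R b))"
      using der[OF p(1)] by simp
    then have "((\<lambda>t. \<delta> (p + t *\<^sub>R b)) has_derivative (\<lambda>t. w p \<bullet> (t *\<^sub>R b))) (at 0)"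
      by (rule has_derivative_compose[rotated]) (auto intro!: derivative_eq_intros)
    then have "((\<lambda>t. \<delta> (p + t *\<^sub>R b)) has_real_derivative w p \<bullet> b) (at 0)"
      unfolding has_field_derivative_def by (rule has_derivative_eq_rhs) (auto simp: mult.commute)
    then have "((\<lambda>t. (\<delta> (p + t *\<^sub>R b) - \<delta> p) / t) \<longlongrightarrow> w p \<bullet> b) (at 0)"
      unfolding DERIV_def by simp
    moreover have "filterlim \<tau> (at 0) sequentially"
      using \<tau>(2) by (simp add: filterlim_at less_imp_neq[OF \<tau>(1), symmetric])
    ultimately have "(\<lambda>j. (\<delta> (p + \<tau> j *\<^sub>R b) - \<delta> p) / \<tau> j) \<longlonglongrightarrow> w p \<bullet> b"
      by (rule filterlim_compose)
    then have "(\<lambda>j. 0) \<longlonglongrightarrow> w p \<bullet> b"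
      using const p(1) \<tau>(3) by simp
    then show False using p(2) LIMSEQ_const_iff by metis
  qed
  then have "(\<Union>b\<in>Basis. {p \<in> S. w p \<bullet> b \<noteq> 0}) \<in> null_sets lebesgue"
    by (intro null_sets_UN') (auto simp: countable_finite)
  moreover have "S \<subseteq> (\<Union>b\<in>Basis. {p \<in> S. w p \<bullet> b \<noteq> 0})"
    using nz euclidean_all_zero_iff by fastforce
  ultimately show ?thesis by (rule null_sets_completion_subset[rotated])
qed

section \<open>Uniqueness of the monotone rearrangement\<close>

text \<open>Aleksandrov's argument: the set where \<open>\<psi>1 - \<psi>2\<close> exceeds its value at \<open>p\<close> contains
  the \<open>v2\<close>-preimage of its own \<open>v1\<close>-image, and that preimage stays away from \<open>p\<close>.\<close>
lemma Aleksandrov_null: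
  fixes \<psi>1 \<psi>2 :: "'a::euclidean_space \<Rightarrow> ereal"
  assumes Y: "Y \<in> sets lebesgue" "emeasure lebesgue Y < \<infinity>"
    and conv: "convex_fun \<psi>1" "convex_fun \<psi>2" and proper: "proper_fun \<psi>1" "proper_fun \<psi>2"
    and D: "D \<subseteq> Y" "Y - D \<in> null_sets lebesgue"
    and grad: "\<And>x. x \<in> D \<Longrightarrow> gradient_at \<psi>1 x (v1 x)" "\<And>x. x \<in> D \<Longrightarrow> gradient_at \<psi>2 x (v2 x)"
    and meas: "v1 \<in> borel_measurable (lebesgue_on Y)" "v2 \<in> borel_measurable (lebesgue_on Y)"
    and eq: "\<And>B. B \<in> sets borel \<Longrightarrow> emeasure lebesgue (v1 -` B \<inter> Y) = emeasure lebesgue (v2 -` B \<inter> Y)"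
    and p: "p \<in> D" "v1 p \<noteq> v2 p"
  obtains r where "0 < r"
    "{x \<in> D. real_of_ereal (\<psi>1 p) - real_of_ereal (\<psi>2 p) < real_of_ereal (\<psi>1 x) - real_of_ereal (\<psi>2 x)}
       \<inter> ball p r \<in> null_sets lebesgue"
proof -
  define F1 where "F1 x = real_of_ereal (\<psi>1 x)" for x
  define F2 where "F2 x = real_of_ereal (\<psi>2 x)" for x
  define k where "k = F1 p - F2 p"
  define M where "M = {x \<in> D. k < F1 x - F2 x}"
  have D_meas: "D \<in> sets lebesgue"
    using sets.Diff[OF Y(1) null_setsD2[OF D(2)]] D(1) by (simp add: double_diff)
  have cF: "continuous_on D F1" "continuous_on D F2"
    unfolding F1_def F2_def using continuous_on_real_of_gradient grad by blast+
  have cv: "continuous_on D v1" "continuous_on D v2"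
    using continuous_on_gradient[OF conv(1) proper(1), of D v1]
      continuous_on_gradient[OF conv(2) proper(2), of D v2] grad by auto
  have sup1: "ereal (F1 y + v1 y \<bullet> (x - y)) \<le> \<psi>1 x" if "y \<in> D" for x y
    unfolding F1_def by (intro gradient_at_support conv proper grad that)
  have sup2: "ereal (F2 y + v2 y \<bullet> (x - y)) \<le> \<psi>2 x" if "y \<in> D" for x y
    unfolding F2_def by (intro gradient_at_support conv proper grad that)
  have fin: "\<psi>1 x = ereal (F1 x)" "\<psi>2 x = ereal (F2 x)" if "x \<in> D" for x
    unfolding F1_def F2_def using gradient_at_finite grad that by blast+
  have "openin (top_of_set D) (D \<inter> (\<lambda>x. F1 x - F2 x) -` {k<..})"
    by (intro continuous_openin_preimage_gen continuous_intros cF)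
  then have M: "M \<in> sets lebesgue"
    using lebesgue_openin[OF _ D_meas] by (simp add: M_def vimage_def Int_def)
  \<comment> \<open>Equality of the two laws can be applied only to Borel sets; replacing
    \<open>M\<close> by a sigma-compact part makes its \<open>v1\<close>-image \<open>B\<close>
    Borel.\<close>
  obtain K where K: "\<And>j::nat. compact (K j)" "\<And>j. K j \<subseteq> M" "M - \<Union>(range K) \<in> null_sets lebesgue"
    by (rule sets_lebesgue_sigma_compact[OF M]) blast
  have MD: "M \<subseteq> D" by (auto simp: M_def)
  define B where "B = (\<Union>j. v1 ` K j)"
  have "compact (v1 ` K j)" for j
    using K MD by (intro compact_continuous_image continuous_on_subset[OF cv(1)]) auto
  then have B: "B \<in> sets borel" unfolding B_def by (intro sets.countable_UN) (auto intro: borel_compact)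
  \<comment> \<open>The plane of \<open>\<psi>2\<close> at \<open>x\<close>, raised by
    \<open>k\<close>, is parallel to the plane of \<open>\<psi>1\<close> at some \<open>y\<close> in
    \<open>M\<close>, and at \<open>y\<close> it lies strictly below it; so it does
    everywhere.\<close>
  have above: "ereal (F2 x + k + v2 x \<bullet> (z - x)) < \<psi>1 z" if x: "x \<in> D" "v2 x \<in> B" for x z
  proof -
    obtain y where y: "y \<in> M" "v2 x = v1 y" using x(2) K(2) unfolding B_def by blast
    then have yD: "y \<in> D" using MD by auto
    have "F2 x + v2 x \<bullet> (y - x) \<le> F2 y"
      using sup2[OF x(1), of y] fin(2)[OF yD] by simp
    moreover have "k < F1 y - F2 y" using y(1) by (simp add: M_def)
    ultimately have "F2 x + k + v2 x \<bullet> (z - x) < F1 y + v1 y \<bullet> (z - y)"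
      unfolding y(2)[symmetric] inner_diff_right by linarith
    then have "ereal (F2 x + k + v2 x \<bullet> (z - x)) < ereal (F1 y + v1 y \<bullet> (z - y))" by simp
    also have "\<dots> \<le> \<psi>1 z" by (rule sup1[OF yD])
    finally show ?thesis .
  qed
  have "x \<in> M" if "x \<in> D" "v2 x \<in> B" for x
    using above[OF that, of x] fin(1)[OF that(1)] that(1) by (simp add: M_def)
  then have sub: "v2 -` B \<inter> D \<subseteq> M" by auto
  \<comment> \<open>For points tending to \<open>p\<close> the raised planes converge to the plane
    of slope \<open>v2 p\<close> through the value of \<open>\<psi>1\<close> at \<open>p\<close>. It
    would support \<open>\<psi>1\<close> there, forcing \<open>v2 p = v1 p\<close>.\<close>
  have "\<exists>r>0. v2 -` B \<inter> D \<inter> ball p r = {}"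
  proof (rule ccontr)
    assume "\<not> ?thesis"
    then have "\<forall>n::nat. \<exists>x. x \<in> v2 -` B \<inter> D \<inter> ball p (1 / Suc n)"
      by (metis all_not_in_conv divide_pos_pos of_nat_0_less_iff zero_less_Suc zero_less_one)
    then obtain \<xi> where \<xi>: "\<And>n::nat. \<xi> n \<in> v2 -` B \<inter> D \<inter> ball p (1 / Suc n)" by metis
    have lim: "\<xi> \<longlonglongrightarrow> p"
    proof (rule metric_tendsto_imp_tendsto[of "\<lambda>n. 1 / Suc n" "0::real"])
      show "(\<lambda>n. 1 / real (Suc n)) \<longlonglongrightarrow> 0"
        using LIMSEQ_inverse_real_of_nat by (simp add: inverse_eq_divide)
      show "\<forall>\<^sub>F n in sequentially. dist (\<xi> n) p \<le> dist (1 / real (Suc n)) 0"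
        using \<xi> by (auto intro!: eventuallyI less_imp_le simp: dist_commute)
    qed
    have "(\<lambda>n. F2 (\<xi> n)) \<longlonglongrightarrow> F2 p" "(\<lambda>n. v2 (\<xi> n)) \<longlonglongrightarrow> v2 p"
      using lim \<xi> p(1) by (auto intro!: continuous_on_tendsto_compose[OF cF(2)]
          continuous_on_tendsto_compose[OF cv(2)] eventuallyI)
    then have lims: "(\<lambda>n. F2 (\<xi> n) + k + v2 (\<xi> n) \<bullet> (z - \<xi> n)) \<longlonglongrightarrow> F2 p + k + v2 p \<bullet> (z - p)" for z
      using lim by (intro tendsto_intros)
    have "ereal (F1 p + v2 p \<bullet> (z - p)) \<le> \<psi>1 z" for z
    proof (cases "\<psi>1 z")
      case (real c)
      have "F2 (\<xi> n) + k + v2 (\<xi> n) \<bullet> (z - \<xi> n) \<le> c" for n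
        using above[of "\<xi> n" z] \<xi>[of n] real by simp
      then have "F2 p + k + v2 p \<bullet> (z - p) \<le> c"
        by (intro LIMSEQ_le_const2[OF lims]) auto
      then show ?thesis using real by (simp add: k_def)
    next
      case MInf
      then show ?thesis using proper(1) by (simp add: proper_fun_def)
    qed simp
    then have "v2 p = v1 p"
      unfolding F1_def by (intro gradient_at_unique_slope[OF grad(1)[OF p(1)]])
    then show False using p(2) by simp
  qed
  then obtain r where r: "0 < r" "v2 -` B \<inter> D \<inter> ball p r = {}" by blast
  have pre: "v1 -` B \<inter> Y \<in> sets lebesgue" "v2 -` B \<inter> Y \<in> sets lebesgue"
    using measurable_sets[OF meas(1) B] measurable_sets[OF meas(2) B] Y(1)
    by (auto simp: sets_restrict_space_iff)
  have Mr: "M - ball p r \<in> sets lebesgue" "M \<inter> ball p r \<in> sets lebesgue"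
    by (intro sets.Diff sets.Int M fmeasurableD lmeasurable_ball)+
  have "emeasure lebesgue M \<le> emeasure lebesgue ((v1 -` B \<inter> Y) \<union> (M - \<Union>(range K)))"
    using K(2) MD D(1) pre K(3) by (intro emeasure_mono) (auto simp: B_def)
  also have "\<dots> = emeasure lebesgue (v1 -` B \<inter> Y)"
    by (intro emeasure_Un_null_set pre K(3))
  also have "\<dots> = emeasure lebesgue (v2 -` B \<inter> Y)" by (rule eq[OF B])
  also have "\<dots> \<le> emeasure lebesgue ((M - ball p r) \<union> (Y - D))"
    using sub r(2) by (intro emeasure_mono sets.Un Mr null_setsD2[OF D(2)]) auto
  also have "\<dots> = emeasure lebesgue (M - ball p r)"
    by (intro emeasure_Un_null_set D(2) Mr)
  finally have le: "emeasure lebesgue M \<le> emeasure lebesgue (M - ball p r)" .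
  have "emeasure lebesgue M \<le> emeasure lebesgue Y"
    using MD D(1) Y(1) by (intro emeasure_mono) auto
  then have fin_M: "emeasure lebesgue (M - ball p r) \<noteq> \<infinity>"
    using Y(2) emeasure_mono[of "M - ball p r" M lebesgue] M by auto
  have "M = (M - ball p r) \<union> (M \<inter> ball p r)" by blast
  moreover have "emeasure lebesgue ((M - ball p r) \<union> (M \<inter> ball p r))
      = emeasure lebesgue (M - ball p r) + emeasure lebesgue (M \<inter> ball p r)"
    by (intro plus_emeasure[symmetric] Mr) auto
  ultimately have "emeasure lebesgue (M - ball p r) + emeasure lebesgue (M \<inter> ball p r)
      \<le> emeasure lebesgue (M - ball p r) + 0"
    using le by simp
  then have "emeasure lebesgue (M \<inter> ball p r) \<le> 0"
    using fin_M by (subst (asm) ennreal_add_left_cancel_le) auto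
  then have "M \<inter> ball p r \<in> null_sets lebesgue"
    using Mr by auto
  then show thesis
    using that[OF r(1)] unfolding M_def k_def F1_def F2_def by simp
qed

text \<open>Near a point where the gradients differ, Aleksandrov's argument in both orders makes the
  sets above and below the level of \<open>\<psi>1 - \<psi>2\<close> null. On the level set itself
  the gradient \<open>v1 - v2\<close> is nonzero at the bad points, so these are null too; a locally
  null set is null.\<close>

lemma monotone_rearrangement_unique:
  fixes \<psi>1 \<psi>2 :: "'a::euclidean_space \<Rightarrow> ereal"
  assumes Y: "Y \<in> sets lebesgue" "emeasure lebesgue Y < \<infinity>"
    and conv: "convex_fun \<psi>1" "convex_fun \<psi>2" and proper: "proper_fun \<psi>1" "proper_fun \<psi>2"
    and grad: "AE x in lebesgue_on Y. gradient_at \<psi>1 x (v1 x)" "AE x in lebesgue_on Y. gradient_at \<psi>2 x (v2 x)"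
    and meas: "v1 \<in> borel_measurable (lebesgue_on Y)" "v2 \<in> borel_measurable (lebesgue_on Y)"
    and eq: "\<And>B. B \<in> sets borel \<Longrightarrow> emeasure lebesgue (v1 -` B \<inter> Y) = emeasure lebesgue (v2 -` B \<inter> Y)"
  shows "AE x in lebesgue_on Y. v1 x = v2 x"
proof -
  define D where "D = {x \<in> Y. gradient_at \<psi>1 x (v1 x) \<and> gradient_at \<psi>2 x (v2 x)}"
  have "AE x in lebesgue. x \<in> Y \<longrightarrow> x \<in> D"
    using grad Y(1) unfolding D_def by (auto simp: AE_restrict_space_iff)
  then obtain N where "N \<in> null_sets lebesgue" "{x \<in> space lebesgue. \<not> (x \<in> Y \<longrightarrow> x \<in> D)} \<subseteq> N"
    unfolding eventually_ae_filter by blast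
  then have D: "D \<subseteq> Y" "Y - D \<in> null_sets lebesgue"
    using null_sets_completion_subset[of "Y - D" N lborel] by (auto simp: D_def)
  have grad_D: "gradient_at \<psi>1 x (v1 x)" "gradient_at \<psi>2 x (v2 x)" if "x \<in> D" for x
    using that by (auto simp: D_def)
  define \<delta> where "\<delta> x = real_of_ereal (\<psi>1 x) - real_of_ereal (\<psi>2 x)" for x
  define Bad where "Bad = {x \<in> D. v1 x \<noteq> v2 x}"
  have D_meas: "D \<in> sets lebesgue"
    using sets.Diff[OF Y(1) null_setsD2[OF D(2)]] D(1) by (simp add: double_diff)
  have cv: "continuous_on D v1" "continuous_on D v2"
    using continuous_on_gradient[OF conv(1) proper(1), of D v1]
      continuous_on_gradient[OF conv(2) proper(2), of D v2] grad_D by auto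
  have cF: "continuous_on D \<delta>"
    unfolding \<delta>_def by (intro continuous_intros continuous_on_real_of_gradient[of D \<psi>1 v1]
        continuous_on_real_of_gradient[of D \<psi>2 v2] grad_D)
  have "openin (top_of_set D) (D \<inter> (\<lambda>x. v1 x - v2 x) -` (- {0}))"
    by (intro continuous_openin_preimage_gen continuous_intros cv)
  then have Bad: "Bad \<in> sets lebesgue"
    using lebesgue_openin[OF _ D_meas] by (simp add: Bad_def vimage_def Int_def)
  have null_near: "\<exists>r>0. Bad \<inter> ball p r \<in> null_sets lebesgue" if p: "p \<in> Bad" for p
  proof -
    have pD: "p \<in> D" "v1 p \<noteq> v2 p" using p by (auto simp: Bad_def)
    obtain r1 where r1: "0 < r1" "{x \<in> D. \<delta> p < \<delta> x} \<inter> ball p r1 \<in> null_sets lebesgue"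
      unfolding \<delta>_def
      using Aleksandrov_null[OF Y conv proper D grad_D meas eq pD] .
    obtain r2 where r2: "0 < r2" "{x \<in> D. - \<delta> p < - \<delta> x} \<inter> ball p r2 \<in> null_sets lebesgue"
      unfolding \<delta>_def minus_diff_eq
      using Aleksandrov_null[OF Y conv(2,1) proper(2,1) D grad_D(2,1) meas(2,1) eq[symmetric] pD(1) pD(2)[symmetric]] .
    have "closedin (top_of_set D) (D \<inter> \<delta> -` {\<delta> p})"
      by (intro continuous_closedin_preimage cF closed_singleton)
    then have "Bad \<inter> (D \<inter> \<delta> -` {\<delta> p}) \<in> sets lebesgue"
      using lebesgue_closedin[OF _ D_meas] Bad by blast
    then have level: "Bad \<inter> (D \<inter> \<delta> -` {\<delta> p}) \<in> null_sets lebesgue"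
    proof (rule level_set_null)
      show "continuous_on (Bad \<inter> (D \<inter> \<delta> -` {\<delta> p})) (\<lambda>x. v1 x - v2 x)"
        by (intro continuous_intros continuous_on_subset[OF cv(1)] continuous_on_subset[OF cv(2)]) auto
      fix x assume "x \<in> Bad \<inter> (D \<inter> \<delta> -` {\<delta> p})"
      then have x: "x \<in> D" "v1 x \<noteq> v2 x" "\<delta> x = \<delta> p" by (auto simp: Bad_def)
      show "(\<delta> has_derivative (\<lambda>h. (v1 x - v2 x) \<bullet> h)) (at x)"
        using grad_D[OF x(1)] unfolding gradient_at_def \<delta>_def inner_diff_left
        by (auto intro: has_derivative_diff)
      show "v1 x - v2 x \<noteq> 0" "\<delta> x = \<delta> p" using x by auto
    qed
    have "({x \<in> D. \<delta> p < \<delta> x} \<inter> ball p r1) \<union> ({x \<in> D. - \<delta> p < - \<delta> x} \<inter> ball p r2)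
        \<union> (Bad \<inter> (D \<inter> \<delta> -` {\<delta> p})) \<in> null_sets lebesgue"
      by (intro null_sets.Un r1 r2 level)
    moreover have "Bad \<inter> ball p (min r1 r2) \<subseteq> ({x \<in> D. \<delta> p < \<delta> x} \<inter> ball p r1)
        \<union> ({x \<in> D. - \<delta> p < - \<delta> x} \<inter> ball p r2) \<union> (Bad \<inter> (D \<inter> \<delta> -` {\<delta> p}))"
      by (auto simp: Bad_def)
    ultimately have "Bad \<inter> ball p (min r1 r2) \<in> null_sets lebesgue"
      by (rule null_sets_completion_subset[rotated])
    then show ?thesis using r1(1) r2(1) by (intro exI[of _ "min r1 r2"]) auto
  qed
  have "negligible Bad"
  proof (rule locally_negligible_alt[THEN iffD2], rule ballI)
    fix p assume p: "p \<in> Bad"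
    obtain r where "0 < r" "Bad \<inter> ball p r \<in> null_sets lebesgue"
      using null_near[OF p] by (elim exE conjE)
    then show "\<exists>U. openin (top_of_set Bad) U \<and> p \<in> U \<and> negligible U"
      using p by (intro exI[of _ "Bad \<inter> ball p r"])
        (simp add: negligible_iff_null_sets openin_open_Int)
  qed
  then have "Bad \<union> (Y - D) \<in> null_sets lebesgue"
    using D(2) by (simp add: negligible_iff_null_sets null_sets.Un)
  moreover have "{x \<in> space lebesgue. \<not> (x \<in> Y \<longrightarrow> v1 x = v2 x)} \<subseteq> Bad \<union> (Y - D)"
    by (auto simp: Bad_def)
  ultimately have "AE x in lebesgue. x \<in> Y \<longrightarrow> v1 x = v2 x"
    by (rule AE_I')
  then show ?thesis using Y(1) by (simp add: AE_restrict_space_iff)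
qed

section \<open>Measure-preserving maps and level sets\<close>

text \<open>For \<open>contact\<close>: a plane supporting at \<open>y\<close> that touches at
  \<open>x\<close> also supports at \<open>x\<close>, where differentiability admits a single
  slope.\<close>

lemma supporting_slopes_gradient:
  fixes \<psi> :: "'a::euclidean_space \<Rightarrow> ereal"
  assumes conv: "convex_fun \<psi>" and proper: "proper_fun \<psi>"
    and grad: "\<And>y. y \<in> Y \<Longrightarrow> gradient_at \<psi> y (v y)"
  shows "supporting_slopes Y (\<lambda>y. real_of_ereal (\<psi> y)) v"
proof
  define F where "F z = real_of_ereal (\<psi> z)" for z
  have sup: "ereal (F y + v y \<bullet> (x - y)) \<le> \<psi> x" if "y \<in> Y" for x y
    unfolding F_def by (intro gradient_at_support conv proper grad that)
  have fin: "\<psi> x = ereal (F x)" if "x \<in> Y" for x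
    unfolding F_def using gradient_at_finite grad that by blast
  fix x y assume xy: "x \<in> Y" "y \<in> Y"
  have "ereal (F y + v y \<bullet> (x - y)) \<le> ereal (F x)"
    using sup[OF xy(2), of x] unfolding fin[OF xy(1)] .
  then show "real_of_ereal (\<psi> y) + v y \<bullet> (x - y) \<le> real_of_ereal (\<psi> x)"
    by (simp add: F_def)
  assume "real_of_ereal (\<psi> x) = real_of_ereal (\<psi> y) + v y \<bullet> (x - y)"
  then have eq: "F x = F y + v y \<bullet> (x - y)" by (simp add: F_def)
  have "ereal (F x + v y \<bullet> (z - x)) \<le> \<psi> z" for z
    using sup[OF xy(2), of z] unfolding eq by (simp add: inner_diff_right)
  then have "v y = v x"
    unfolding F_def by (intro gradient_at_unique_slope[OF grad[OF xy(1)]])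
  then show "v x = v y" ..
next
  show "continuous_on Y (\<lambda>y. real_of_ereal (\<psi> y))"
    by (rule continuous_on_real_of_gradient[OF grad])
  show "continuous_on Y v"
    by (rule continuous_on_gradient[OF conv proper grad])
qed

text \<open>Measure preservation is stated for Borel sets, while \<open>N\<close> is only Lebesgue
  null. The remedy is a sigma-compact subset of \<open>Y - N\<close> of full measure, whose preimage
  has full measure.\<close>

lemma AE_measure_preserving_map_notin:
  assumes fin: "finite_measure M" and mp: "measure_preserving_map M Y s"
    and Y: "Y \<in> sets lebesgue" and N: "N \<in> null_sets lebesgue" "N \<subseteq> Y"
  shows "AE x in M. s x \<notin> N"
proof -
  interpret finite_measure M by (rule fin)
  have YN: "Y - N \<in> sets lebesgue" using Y null_setsD2[OF N(1)] by (rule sets.Diff)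
  obtain K where K: "\<And>j::nat. compact (K j)" "\<And>j. K j \<subseteq> Y - N" "(Y - N) - \<Union>(range K) \<in> null_sets lebesgue"
    by (rule sets_lebesgue_sigma_compact[OF YN]) blast
  define G where "G = \<Union>(range K)"
  have G: "G \<in> sets borel" unfolding G_def using K(1) by (auto intro: borel_compact)
  have "Y = G \<union> (((Y - N) - G) \<union> N)" using K(2) N(2) unfolding G_def by auto
  moreover have "emeasure lebesgue (G \<union> (((Y - N) - G) \<union> N)) = emeasure lebesgue G"
    using G K(3) N(1) by (intro emeasure_Un_null_set null_sets.Un) (auto simp: G_def)
  ultimately have "emeasure lebesgue G = emeasure M (space M)"
    using mp by (simp add: measure_preserving_map_def)
  moreover have GY: "G \<subseteq> Y" using K(2) unfolding G_def by auto
  ultimately have sG: "s -` G \<inter> space M \<in> sets M" "emeasure M (s -` G \<inter> space M) = emeasure M (space M)"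
    using mp G by (auto simp: measure_preserving_map_def)
  then have "emeasure M (space M - s -` G \<inter> space M) = 0"
    by (subst emeasure_compl) auto
  then have "space M - s -` G \<inter> space M \<in> null_sets M"
    using sG(1) by auto
  moreover have "{x \<in> space M. \<not> s x \<notin> N} \<subseteq> space M - s -` G \<inter> space M"
    using K(2) unfolding G_def by auto
  ultimately show ?thesis by (rule AE_I')
qed

lemma pos_level_complement_eq:
  "pos_level_complement M f = f -` (- {a. 0 < emeasure M (f -` {a} \<inter> space M)}) \<inter> space M"
  unfolding pos_level_complement_def by auto

lemma countable_pos_levels:
  fixes f :: "'b \<Rightarrow> 'a::euclidean_space"
  assumes fin: "finite_measure M" and f: "f \<in> borel_measurable M"
  shows "countable {a. 0 < emeasure M (f -` {a} \<inter> space M)}"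
proof -
  interpret finite_measure M by (rule fin)
  interpret D: finite_measure "distr M borel f" using f by (rule finite_measure_distr)
  have "{a. 0 < emeasure M (f -` {a} \<inter> space M)} = {a. measure (distr M borel f) {a} \<noteq> 0}"
    using f by (auto simp: measure_distr emeasure_eq_measure zero_less_measure_iff)
  then show ?thesis using D.countable_support by simp
qed

text \<open>Equal laws have the same atoms, and these are countably many. One Borel set of values
  thus describes both complements, which therefore have equal measure.\<close>

lemma rearrangement_pos_level_complement:
  assumes "rearrangement M u N g"
  obtains Q where "Q \<in> sets borel" "pos_level_complement M u = u -` Q \<inter> space M"
    "pos_level_complement N g = g -` Q \<inter> space N"
proof (rule that)
  have u: "finite_measure M" "u \<in> borel_measurable M"
    using assms by (auto simp: rearrangement_def)
  show "- {a. 0 < emeasure M (u -` {a} \<inter> space M)} \<in> sets borel"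
    using countable_pos_levels[OF u] sets.countable by (metis borel_comp closed_singleton borel_closed)
  show "pos_level_complement M u = u -` (- {a. 0 < emeasure M (u -` {a} \<inter> space M)}) \<inter> space M"
    by (rule pos_level_complement_eq)
  have "emeasure M (u -` {a} \<inter> space M) = emeasure N (g -` {a} \<inter> space N)" for a
    using assms by (auto simp: rearrangement_def)
  then show "pos_level_complement N g = g -` (- {a. 0 < emeasure M (u -` {a} \<inter> space M)}) \<inter> space N"
    by (simp add: pos_level_complement_eq)
qed

text \<open>Lusin's theorem, applied to \<open>s\<close> read in the interval model of the measure space,
  provides the compact sets.\<close>
lemma measure_preserving_image_sigma_compact:
  fixes s :: "'b \<Rightarrow> 'a::euclidean_space"
  assumes int: "measure_interval M" and mp: "measure_preserving_map M Y s" and Y: "Y \<in> sets lebesgue"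
    and X: "X \<in> sets M"
  obtains K :: "nat \<Rightarrow> 'a set" where "\<And>j. compact (K j)" "\<Union>(range K) \<subseteq> s ` X"
    "emeasure M X \<le> emeasure lebesgue (\<Union>(range K))"
proof -
  from int obtain X' I' and \<tau> :: "'b \<Rightarrow> real" where fin: "finite_measure M"
    and X': "X' \<in> sets M" "space M - X' \<in> null_sets M"
    and bij: "bij_betw \<tau> X' I'"
    and pre: "\<forall>A. A \<in> sets lebesgue \<and> A \<subseteq> I' \<longrightarrow>
             \<tau> -` A \<inter> X' \<in> sets M \<and> emeasure M (\<tau> -` A \<inter> X') = emeasure lebesgue A"
    and img: "\<forall>B. B \<in> sets M \<and> B \<subseteq> X' \<longrightarrow>
             \<tau> ` B \<in> sets lebesgue \<and> emeasure lebesgue (\<tau> ` B) = emeasure M B"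
    unfolding measure_interval_def by (elim conjE exE) (rule that; assumption)
  have X'_space: "X' \<subseteq> space M" using X'(1) by (rule sets.sets_into_space)
  have inv: "inv_into X' \<tau> (\<tau> x) = x" if "x \<in> X'" for x
    using bij that by (simp add: bij_betw_inv_into_left)
  obtain K0 where K0: "\<And>j::nat. compact (K0 j)" "\<And>j. K0 j \<subseteq> Y" "Y - \<Union>(range K0) \<in> null_sets lebesgue"
    by (rule sets_lebesgue_sigma_compact[OF Y]) blast
  \<comment> \<open>An open set cut down to \<open>Y\<close> need not be Borel, whereas its
    intersection with \<open>G\<close> is, so that \<open>mp\<close> applies to it.\<close>
  define G where "G = \<Union>(range K0)"
  have G: "G \<in> sets borel" "G \<subseteq> Y" unfolding G_def using K0(1,2) by (auto intro: borel_compact)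
  have s_pre: "s -` A \<inter> space M \<in> sets M" "emeasure M (s -` A \<inter> space M) = emeasure lebesgue A"
    if "A \<in> sets borel" "A \<subseteq> Y" for A
    using mp that by (auto simp: measure_preserving_map_def)
  define X2 where "X2 = X \<inter> X' \<inter> (s -` G \<inter> space M)"
  have X2: "X2 \<in> sets M" unfolding X2_def by (intro sets.Int X X'(1) s_pre G)
  have "AE x in M. s x \<notin> Y - G"
    using K0(3) by (intro AE_measure_preserving_map_notin[OF fin mp Y]) (auto simp: G_def)
  moreover have "AE x in M. x \<notin> space M - X'" by (rule AE_not_in[OF X'(2)])
  ultimately have "AE x in M. x \<in> X \<longleftrightarrow> x \<in> X2"
    using AE_space
  proof eventually_elim
    case (elim x)
    then have "s x \<in> Y" using mp by (auto simp: measure_preserving_map_def)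
    then show ?case using elim by (auto simp: X2_def)
  qed
  then have X2_em: "emeasure M X = emeasure M X2" by (intro emeasure_eq_AE X X2)
  define I where "I = \<tau> ` X2"
  have "X2 \<subseteq> X'" by (auto simp: X2_def)
  then have I: "I \<in> sets lebesgue" "emeasure lebesgue I = emeasure M X2" "I \<subseteq> I'"
    using img X2 bij by (auto simp: I_def bij_betw_def)
  define h where "h t = s (inv_into X' \<tau> t)" for t
  have h: "h (\<tau> x) = s x" if "x \<in> X'" for x using inv that by (simp add: h_def)
  have h_meas: "{t \<in> I. h t \<in> U} \<in> sets lebesgue" if "open U" for U
  proof -
    have "{t \<in> I. h t \<in> U} = \<tau> ` (X2 \<inter> (s -` (U \<inter> G) \<inter> space M))"
      using h by (auto simp: I_def X2_def)
    moreover have "X2 \<inter> (s -` (U \<inter> G) \<inter> space M) \<in> sets M"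
      using that G by (intro sets.Int X2 s_pre) auto
    ultimately show ?thesis using img \<open>X2 \<subseteq> X'\<close> by (simp add: le_infI1)
  qed
  obtain K :: "nat \<Rightarrow> real set" where K: "\<And>j. compact (K j)" "\<And>j. K j \<subseteq> I" "\<And>j. continuous_on (K j) h"
      "I - \<Union>(range K) \<in> null_sets lebesgue"
    by (rule Lusin_sigma_compact[OF I(1)]) (erule h_meas, rule that)
  define T where "T = \<Union>(range K)"
  have T: "T \<in> sets lebesgue" "T \<subseteq> I"
    unfolding T_def using K(1,2) by (auto intro!: sets.countable_UN simp: borel_compact)
  have "emeasure lebesgue (T \<union> (I - T)) = emeasure lebesgue T"
    using K(4) by (intro emeasure_Un_null_set T) (simp add: T_def)
  then have T_em: "emeasure lebesgue T = emeasure M X"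
    using T(2) I(2) X2_em by (simp add: Un_absorb1)
  \<comment> \<open>The size of \<open>C\<close> is read off its preimage under \<open>s\<close>,
    which contains \<open>X\<close> up to a null set.\<close>
  define C where "C = (\<Union>j. h ` K j)"
  have hK: "compact (h ` K j)" for j by (intro compact_continuous_image K)
  have CX: "C \<subseteq> s ` X2"
  proof
    fix c assume "c \<in> C"
    then obtain t where "t \<in> I" "c = h t" using K(2) by (auto simp: C_def)
    then show "c \<in> s ` X2" using h \<open>X2 \<subseteq> X'\<close> by (auto simp: I_def)
  qed
  have "C \<in> sets borel"
    unfolding C_def using hK by (intro sets.countable_UN) (auto intro: borel_compact)
  moreover have "s ` X2 \<subseteq> Y" using G(2) by (auto simp: X2_def)
  ultimately have C: "C \<in> sets borel" "C \<subseteq> Y" using CX by auto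
  show thesis
  proof (rule that[of "\<lambda>j. h ` K j"])
    show "\<Union>(range (\<lambda>j. h ` K j)) \<subseteq> s ` X"
      using CX by (auto simp: C_def X2_def)
    have "emeasure M (\<tau> -` T \<inter> X') = emeasure lebesgue T"
      using pre T I(3) by blast
    then have "emeasure M X = emeasure M (\<tau> -` T \<inter> X')"
      using T_em by simp
    also have "\<dots> \<le> emeasure M (s -` C \<inter> space M)"
    proof (intro emeasure_mono s_pre C subsetI)
      fix x assume x: "x \<in> \<tau> -` T \<inter> X'"
      then have "h (\<tau> x) \<in> C" by (auto simp: T_def C_def)
      then show "x \<in> s -` C \<inter> space M" using x h X'_space by auto
    qed
    also have "\<dots> = emeasure lebesgue C" by (intro s_pre C)
    finally show "emeasure M X \<le> emeasure lebesgue (\<Union>(range (\<lambda>j. h ` K j)))"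
      by (simp add: C_def)
  qed (rule hK)
qed

section \<open>Exclusion of a polar factorisation\<close>

theorem theorem1:
  fixes Y :: "'a::euclidean_space set"
    and ustar :: "'a \<Rightarrow> 'a"
    and \<psi> :: "'a \<Rightarrow> ereal"
    and M :: "'b measure"
    and u :: "'b \<Rightarrow> 'a"
  assumes Y_meas: "Y \<in> sets lebesgue"
    and Y_pos: "0 < emeasure lebesgue Y" and Y_fin: "emeasure lebesgue Y < \<infinity>"
    and ustar_int: "integrable (lebesgue_on Y) ustar"
    and psi: "proper_fun \<psi>" "lsc_fun \<psi>" "convex_fun \<psi>"
    and grad: "\<forall>y\<in>Y. gradient_at \<psi> y (ustar y)"
    and not_inj: "\<not> almost_injective_on (lebesgue_on Y) ustar
                     (pos_level_complement (lebesgue_on Y) ustar)"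
    and M_int: "measure_interval M"
    and M_meas: "emeasure M (space M) = emeasure lebesgue Y"
    and rearr: "rearrangement M u (lebesgue_on Y) ustar"
    and ctbl: "almost_countable_to_one_on M u (pos_level_complement M u)"
  shows "\<not> has_polar_factorisation M u Y"
proof
  assume "has_polar_factorisation M u Y"
  then obtain v s \<phi> where v: "rearrangement M u (lebesgue_on Y) v"
    and \<phi>: "proper_fun \<phi>" "convex_fun \<phi>" "AE y in lebesgue_on Y. gradient_at \<phi> y (v y)"
    and mp: "measure_preserving_map M Y s" and ae: "AE x in M. u x = v (s x)"
    unfolding has_polar_factorisation_def monotone_rearrangement_def by blast
  have fin: "finite_measure M" and complete: "complete_measure M"
    using M_int by (auto simp: measure_interval_def)
  have space_Y: "space (lebesgue_on Y) = Y" by simp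
  have em_Y: "emeasure (lebesgue_on Y) A = emeasure lebesgue A" if "A \<subseteq> Y" for A
    using that Y_meas by (intro emeasure_restrict_space) auto
  have sY: "s x \<in> Y" if "x \<in> space M" for x
    using mp that by (auto simp: measure_preserving_map_def)

  have "AE y in lebesgue_on Y. v y = ustar y"
  proof (rule monotone_rearrangement_unique[OF Y_meas Y_fin \<phi>(2) psi(3) \<phi>(1) psi(1) \<phi>(3)])
    show "AE y in lebesgue_on Y. gradient_at \<psi> y (ustar y)"
      using grad by (intro AE_I2) simp
    show "v \<in> borel_measurable (lebesgue_on Y)" "ustar \<in> borel_measurable (lebesgue_on Y)"
      using v ustar_int by (auto simp: rearrangement_def)
    fix B :: "'a set" assume "B \<in> sets borel"
    then have "emeasure (lebesgue_on Y) (v -` B \<inter> Y) = emeasure (lebesgue_on Y) (ustar -` B \<inter> Y)"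
      using v rearr unfolding rearrangement_def space_Y by metis
    then show "emeasure lebesgue (v -` B \<inter> Y) = emeasure lebesgue (ustar -` B \<inter> Y)"
      by (simp add: em_Y)
  qed
  then obtain N where N: "N \<in> null_sets (lebesgue_on Y)" "{y \<in> space (lebesgue_on Y). v y \<noteq> ustar y} \<subseteq> N"
    unfolding eventually_ae_filter by blast
  then have "N \<in> null_sets lebesgue" "N \<subseteq> Y"
    using Y_meas by (auto simp: null_sets_restrict_space)
  then have "AE x in M. s x \<notin> N"
    by (intro AE_measure_preserving_map_notin[OF fin mp Y_meas])
  with ae have u_eq: "AE x in M. u x = ustar (s x)"
    using AE_space
  proof eventually_elim
    case (elim x)
    then show ?case using sY[of x] N(2) unfolding space_Y by auto
  qed

  obtain Q where Q: "Q \<in> sets borel" "pos_level_complement M u = u -` Q \<inter> space M"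
    "pos_level_complement (lebesgue_on Y) ustar = ustar -` Q \<inter> Y"
    using rearrangement_pos_level_complement[OF rearr] unfolding space_Y by blast
  define X0 where "X0 = u -` Q \<inter> space M"
  define Y0 where "Y0 = ustar -` Q \<inter> Y"
  have X0: "X0 \<in> sets M"
    using rearr Q(1) unfolding X0_def rearrangement_def by (auto intro: measurable_sets)
  have "Y0 \<in> sets (lebesgue_on Y)"
    using measurable_sets[of ustar "lebesgue_on Y" borel Q] ustar_int Q(1) unfolding Y0_def by simp
  then have Y0: "Y0 \<in> sets lebesgue"
    using Y_meas by (auto simp: sets_restrict_space_iff)
  have X0_Y0: "emeasure M X0 = emeasure lebesgue Y0"
    using rearr Q(1) em_Y[of Y0] unfolding X0_def Y0_def rearrangement_def space_Y by auto
  obtain U where U: "U \<subseteq> X0" "X0 - U \<in> null_sets M" "\<And>a. countable (u -` {a} \<inter> U)"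
    using ctbl unfolding almost_countable_to_one_on_def Q(2) X0_def by blast

  \<comment> \<open>\<open>X\<close> differs from \<open>X0\<close> by a subset of a null set, so
    completeness of \<open>M\<close> makes it measurable.\<close>
  define X where "X = {x \<in> U. u x = ustar (s x)}"
  have "AE x in M. x \<in> X0 \<longrightarrow> x \<in> X"
    using u_eq AE_not_in[OF U(2)] by eventually_elim (auto simp: X_def)
  then obtain R where R: "R \<in> null_sets M" "{x \<in> space M. \<not> (x \<in> X0 \<longrightarrow> x \<in> X)} \<subseteq> R"
    unfolding eventually_ae_filter by blast
  then have "X0 - X \<subseteq> R" by (auto simp: X0_def)
  then have "X0 - X \<in> null_sets M"
    using complete_measure.complete2[OF complete _ R(1)] by blast
  moreover have XX0: "X = X0 - (X0 - X)" using U(1) by (auto simp: X_def)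
  ultimately have X: "X \<in> sets M" "emeasure M X = emeasure M X0"
    using X0 by (metis sets.Diff null_setsD2, metis emeasure_Diff_null_set)

  \<comment> \<open>The union lies in \<open>Y0\<close>, and its measure is at least that of
    \<open>X0\<close>, which equals that of \<open>Y0\<close>; so it exhausts \<open>Y0\<close> up
    to a null set.\<close>
  obtain K :: "nat \<Rightarrow> 'a set" where K: "\<And>j. compact (K j)" "\<Union>(range K) \<subseteq> s ` X"
    "emeasure M X \<le> emeasure lebesgue (\<Union>(range K))"
    by (rule measure_preserving_image_sigma_compact[OF M_int mp Y_meas X(1)]) blast
  define C where "C = \<Union>(range K)"
  have C: "C \<in> sets lebesgue"
    unfolding C_def using K(1) by (auto intro!: sets.countable_UN simp: borel_compact)
  have CY0: "C \<subseteq> Y0"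
  proof
    fix c assume "c \<in> C"
    then obtain x where x: "x \<in> X" "c = s x" using K(2) by (auto simp: C_def)
    then have "x \<in> X0" using U(1) by (auto simp: X_def)
    then show "c \<in> Y0" using x sY[of x] by (simp add: X0_def Y0_def X_def)
  qed
  have "emeasure lebesgue Y0 \<le> emeasure lebesgue Y"
    using Y_meas by (intro emeasure_mono) (auto simp: Y0_def)
  then have Y0_fin: "emeasure lebesgue Y0 < \<infinity>" using Y_fin by (rule le_less_trans)
  moreover have "emeasure lebesgue C \<le> emeasure lebesgue Y0"
    using CY0 Y0 by (rule emeasure_mono)
  ultimately have C_fin: "emeasure lebesgue C \<noteq> \<infinity>" by auto
  have "emeasure lebesgue (Y0 - C) = emeasure lebesgue Y0 - emeasure lebesgue C"
    by (intro emeasure_Diff C_fin Y0 C CY0)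
  also have "\<dots> = 0"
    using Y0_fin K(3) X(2) X0_Y0 by (intro diff_eq_0_ennreal) (auto simp: C_def)
  finally have Y0_C: "Y0 - C \<in> null_sets lebesgue"
    using Y0 C by auto

  interpret supporting_slopes Y "\<lambda>y. real_of_ereal (\<psi> y)" ustar
    using grad by (intro supporting_slopes_gradient psi(1,3)) blast
  have KY: "K j \<subseteq> Y" for j using CY0 by (auto simp: C_def Y0_def)
  \<comment> \<open>Each point of \<open>C\<close> is \<open>s x\<close> with \<open>x\<close> in
    \<open>U\<close> and \<open>u x = ustar (s x)\<close>, so a fibre of \<open>ustar\<close> in
    \<open>C\<close> is covered by the \<open>s\<close>-image of a countable fibre of
    \<open>u\<close>.\<close>
  have "countable {y \<in> C. ustar y = a}" for a
  proof (rule countable_subset[OF _ countable_image[OF U(3)[of a], of s]])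
    show "{y \<in> C. ustar y = a} \<subseteq> s ` (u -` {a} \<inter> U)"
    proof
      fix c assume c: "c \<in> {y \<in> C. ustar y = a}"
      then obtain x where "x \<in> X" "c = s x" using K(2) by (auto simp: C_def)
      then show "c \<in> s ` (u -` {a} \<inter> U)" using c by (auto simp: X_def)
    qed
  qed
  then have "{y \<in> C. \<exists>y'\<in>C. y' \<noteq> y \<and> ustar y' = ustar y} \<in> null_sets lebesgue" (is "?bad \<in> _")
    unfolding C_def by (intro null_noninjectivity_points K(1) KY)
  then have "(Y0 - C) \<union> ?bad \<in> null_sets lebesgue"
    using Y0_C by (rule null_sets.Un[rotated])
  then have "Y0 - (C - ?bad) \<in> null_sets lebesgue"
    by (rule null_sets_completion_subset[rotated]) blast
  then have "Y0 - (C - ?bad) \<in> null_sets (lebesgue_on Y)"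
    using Y_meas by (auto simp: null_sets_restrict_space Y0_def)
  moreover have "inj_on ustar (C - ?bad)"
    unfolding inj_on_def by blast
  ultimately have "almost_injective_on (lebesgue_on Y) ustar Y0"
    unfolding almost_injective_on_def using CY0 by (intro exI[of _ "C - ?bad"]) auto
  then show False
    using not_inj by (simp add: Q(3) Y0_def)
qed

end
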